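(* Let $G=(L\cup R,E)$ be an $n$-node bipartite graph in which every node of $L$ has degree at most $\Delta$. For every $\lambda\geq 1/\mathrm{polylog}\, n$, the problem of finding a maximal independent $\lceil\lambda\Delta\rceil$-star set of $G$ is $\mathsf{P}$-$\mathsf{SLOCAL}$-complete.
   Context: For a positive integer $k$, a $k$-star of the bipartite graph $G=(L\cup R,E)$ is a node $u\in L$ together with $k$ of its neighbors $v_1,\dots,v_k\in R$. A maximal independent $k$-star set is a maximal collection of pairwise vertex-disjoint $k$-stars of $G$. $G$ is the communication network. $\mathsf{P}$-$\mathsf{SLOCAL}$ is the class of problems solvable by a deterministic SLOCAL algorithm with locality $\mathrm{polylog}\, n$ (nodes processed sequentially in an arbitrary order, each reading its $\mathrm{polylog}\, n$-hop neighborhood including information stored by previously processed nodes). A problem $\mathcal A$ is $\mathsf{P}$-$\mathsf{SLOCAL}$-complete if $\mathcal A\in\mathsf{P}$-$\mathsf{SLOCAL}$ and, if $\mathcal A$ had a deterministic LOCAL algorithm with $\mathrm{polylog}\, n$ rounds, then every problem in $\mathsf{P}$-$\mathsf{SLOCAL}$ would have one. *)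

theory Defs
  imports Complex_Main "HOL-Library.Landau_Symbols" "Graph_Theory.Pair_Digraph"
begin

definition polylog :: "(nat \<Rightarrow> real) \<Rightarrow> bool" where
  "polylog f \<longleftrightarrow> (\<exists>k::nat. f \<in> O(\<lambda>n. ln (real n) ^ k))"


section \<open>Networks and distributed graph problems\<close>

text \<open>
  A simple graph is a symmetric loop-free pair digraph (\<^locale>\<open>pair_graph\<close>); every edge is
  represented by both of its arcs. Nodes are identified with their unique identifiers, and \<open>c\<close> bounds
  the identifiers by \<open>n ^ c\<close>, so that they have \<open>O(log n)\<close> bits.
\<close>

type_synonym graph = "nat pair_pre_digraph"

definition num_nodes :: "graph \<Rightarrow> nat" where
  "num_nodes G = card (pverts G)"

definition network :: "nat \<Rightarrow> graph \<Rightarrow> bool" where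
  "network c G \<longleftrightarrow> pair_graph G \<and> pverts G \<noteq> {} \<and> pverts G \<subseteq> {..<num_nodes G ^ c}"

definition neighbours :: "graph \<Rightarrow> nat \<Rightarrow> nat set" where
  "neighbours G v = {u. (v, u) \<in> parcs G}"

definition hop_ball :: "graph \<Rightarrow> nat \<Rightarrow> nat \<Rightarrow> nat set" where
  "hop_ball G r v = {u. \<exists>i\<le>r. (v, u) \<in> parcs G ^^ i}"

text \<open>
  An input or output labelling is a partial map whose domain is the node set. A problem consists of
  the admissible instances (graph and input labelling) and, for these, the admissible outputs.
\<close>

record ('i, 'o) problem =
  is_instance :: "graph \<Rightarrow> (nat \<rightharpoonup> 'i) \<Rightarrow> bool"
  is_solution :: "graph \<Rightarrow> (nat \<rightharpoonup> 'i) \<Rightarrow> (nat \<rightharpoonup> 'o) \<Rightarrow> bool"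

definition valid_input :: "('i, 'o) problem \<Rightarrow> nat \<Rightarrow> graph \<Rightarrow> (nat \<rightharpoonup> 'i) \<Rightarrow> bool" where
  "valid_input P c G x \<longleftrightarrow> network c G \<and> dom x = pverts G \<and> is_instance P G x"


section \<open>The LOCAL model\<close>

text \<open>
  Synchronous message passing with unrestricted local computation and message size. States and
  messages are finite pieces of information, coded as natural numbers. Initially a node knows the
  number of nodes, its identifier and its input; messages are addressed by the identifier of the
  receiver and tagged with the identifier of the sender.
\<close>

record ('i, 'o) local_alg =
  rounds  :: "nat \<Rightarrow> nat"
  init    :: "nat \<Rightarrow> nat \<Rightarrow> 'i \<Rightarrow> nat"
  send    :: "nat \<Rightarrow> nat \<Rightarrow> nat"
  receive :: "nat \<Rightarrow> (nat \<rightharpoonup> nat) \<Rightarrow> nat"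
  result  :: "nat \<Rightarrow> 'o"

fun local_state ::
  "('i, 'o) local_alg \<Rightarrow> graph \<Rightarrow> (nat \<rightharpoonup> 'i) \<Rightarrow> nat \<Rightarrow> nat \<Rightarrow> nat" where
  "local_state A G x 0 v = init A (num_nodes G) v (the (x v))"
| "local_state A G x (Suc t) v =
     receive A (local_state A G x t v)
       (\<lambda>u. if u \<in> neighbours G v then Some (send A (local_state A G x t u) v) else None)"

definition local_output ::
  "('i, 'o) local_alg \<Rightarrow> graph \<Rightarrow> (nat \<rightharpoonup> 'i) \<Rightarrow> (nat \<rightharpoonup> 'o)" where
  "local_output A G x =
     (\<lambda>v. if v \<in> pverts G
          then Some (result A (local_state A G x (rounds A (num_nodes G)) v)) else None)"

definition local_solves :: "nat \<Rightarrow> ('i, 'o) local_alg \<Rightarrow> ('i, 'o) problem \<Rightarrow> bool" where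
  "local_solves c A P \<longleftrightarrow>
     (\<forall>G x. valid_input P c G x \<longrightarrow> is_solution P G x (local_output A G x))"

definition P_LOCAL :: "('i, 'o) problem set" where
  "P_LOCAL = {P. \<forall>c. \<exists>A. polylog (\<lambda>n. real (rounds A n)) \<and> local_solves c A P}"


section \<open>The SLOCAL model\<close>

text \<open>
  When a node is processed, it sees the subgraph induced by its ball together with the inputs of
  the nodes in it and the information stored by those that have been processed already (\<open>None\<close> for
  the others). From this it computes what it stores itself, and its output.
\<close>

record 'i view =
  centre      :: nat
  view_graph  :: graph
  view_input  :: "nat \<rightharpoonup> 'i"
  view_memory :: "nat \<rightharpoonup> nat"

record ('i, 'o) slocal_alg =
  locality :: "nat \<Rightarrow> nat"
  process  :: "nat \<Rightarrow> 'i view \<Rightarrow> nat \<times> 'o"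

definition view_at :: "graph \<Rightarrow> (nat \<rightharpoonup> 'i) \<Rightarrow> (nat \<rightharpoonup> nat) \<Rightarrow> nat \<Rightarrow> nat \<Rightarrow> 'i view" where
  "view_at G x m r v =
     (let B = hop_ball G r v in
      \<lparr> centre = v,
        view_graph = \<lparr> pverts = B, parcs = parcs G \<inter> B \<times> B \<rparr>,
        view_input = x |` B,
        view_memory = m |` B \<rparr>)"

definition slocal_step ::
  "('i, 'o) slocal_alg \<Rightarrow> graph \<Rightarrow> (nat \<rightharpoonup> 'i) \<Rightarrow> nat \<Rightarrow> (nat \<rightharpoonup> nat \<times> 'o) \<Rightarrow> (nat \<rightharpoonup> nat \<times> 'o)" where
  "slocal_step A G x v s =
     s(v \<mapsto> process A (num_nodes G)
              (view_at G x (map_option fst \<circ> s) (locality A (num_nodes G)) v))"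

definition slocal_output ::
  "('i, 'o) slocal_alg \<Rightarrow> graph \<Rightarrow> (nat \<rightharpoonup> 'i) \<Rightarrow> nat list \<Rightarrow> (nat \<rightharpoonup> 'o)" where
  "slocal_output A G x vs = map_option snd \<circ> fold (slocal_step A G x) vs Map.empty"

definition slocal_solves :: "nat \<Rightarrow> ('i, 'o) slocal_alg \<Rightarrow> ('i, 'o) problem \<Rightarrow> bool" where
  "slocal_solves c A P \<longleftrightarrow>
     (\<forall>G x vs. valid_input P c G x \<and> distinct vs \<and> set vs = pverts G
        \<longrightarrow> is_solution P G x (slocal_output A G x vs))"

definition P_SLOCAL :: "('i, 'o) problem set" where
  "P_SLOCAL = {P. \<forall>c. \<exists>A. polylog (\<lambda>n. real (locality A n)) \<and> slocal_solves c A P}"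

text \<open>
  The problems in the class have finite input and output labels, coded as natural numbers.
\<close>

definition P_SLOCAL_complete :: "('i, 'o) problem \<Rightarrow> bool" where
  "P_SLOCAL_complete P \<longleftrightarrow>
     P \<in> P_SLOCAL \<and>
     (P \<in> P_LOCAL \<longrightarrow> (\<forall>Q :: (nat, nat) problem. Q \<in> P_SLOCAL \<longrightarrow> Q \<in> P_LOCAL))"


section \<open>Maximal independent star sets\<close>

text \<open>A star is the pair of its centre and its set of leaves.\<close>

definition is_star :: "graph \<Rightarrow> nat set \<Rightarrow> nat \<Rightarrow> nat \<times> nat set \<Rightarrow> bool" where
  "is_star G L k = (\<lambda>(u, S). u \<in> L \<and> S \<subseteq> neighbours G u \<and> finite S \<and> card S = k)"

definition star_nodes :: "nat \<times> nat set \<Rightarrow> nat set" where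
  "star_nodes = (\<lambda>(u, S). insert u S)"

definition independent_star_set ::
  "graph \<Rightarrow> nat set \<Rightarrow> nat \<Rightarrow> (nat \<times> nat set) set \<Rightarrow> bool" where
  "independent_star_set G L k M \<longleftrightarrow>
     (\<forall>s\<in>M. is_star G L k s) \<and> pairwise (\<lambda>s t. disjnt (star_nodes s) (star_nodes t)) M"

definition maximal_independent_star_set ::
  "graph \<Rightarrow> nat set \<Rightarrow> nat \<Rightarrow> (nat \<times> nat set) set \<Rightarrow> bool" where
  "maximal_independent_star_set G L k M \<longleftrightarrow>
     independent_star_set G L k M \<and>
     (\<forall>M'. independent_star_set G L k M' \<and> M \<subseteq> M' \<longrightarrow> M' = M)"

text \<open>
  Every node is given its side of the bipartition and the common degree bound \<open>d\<close>. It is positive,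
  since \<open>k\<close>-stars are defined for positive \<open>k\<close> only.
\<close>

datatype side = LSide | RSide

definition bipartite_input ::
  "graph \<Rightarrow> nat set \<Rightarrow> nat set \<Rightarrow> nat \<Rightarrow> (nat \<rightharpoonup> side \<times> nat) \<Rightarrow> bool" where
  "bipartite_input G L R d x \<longleftrightarrow>
     pverts G = L \<union> R \<and> L \<inter> R = {} \<and> parcs G \<subseteq> L \<times> R \<union> R \<times> L \<and>
     0 < d \<and> (\<forall>u\<in>L. card (neighbours G u) \<le> d) \<and>
     x = (\<lambda>v. if v \<in> L then Some (LSide, d) else if v \<in> R then Some (RSide, d) else None)"

text \<open>
  The output of a node is the set of leaves of the star centred at it, or \<open>None\<close> if there is no
  such star in the collection.
\<close>

definition star_set_problem :: "(nat \<Rightarrow> real) \<Rightarrow> (side \<times> nat, nat set option) problem" where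
  "star_set_problem lam =
     \<lparr> is_instance = (\<lambda>G x. \<exists>L R d. bipartite_input G L R d x),
       is_solution = (\<lambda>G x y. \<exists>L R d. bipartite_input G L R d x \<and>
          maximal_independent_star_set G L (nat \<lceil>lam (num_nodes G) * real d\<rceil>)
            {(u, S). y u = Some (Some S)}) \<rparr>"

end

theory Submission
  imports Defs "HOL-Library.Product_Lexorder"
begin

text \<open>
  The star set problem is solved greedily with locality 2. For hardness no reduction is needed, since
  deterministic polylogarithmic network decomposition makes the two classes coincide. The algorithm
  of Rozhon and Ghaffari clusters at least half of the nodes such that distinct clusters are not
  adjacent in the power graph whose distance is the SLOCAL locality: going through the bits of the
  identifiers, clusters whose label has the bit 0 absorb neighbouring nodes with the bit 1 as long as
  this makes them grow by a factor of 1 + 1/(2b), where b is the number of bits, and otherwise kill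
  these few neighbours. Repetition on the remaining nodes yields logarithmically many colours. Processing the nodes colour by colour, each
  cluster can be simulated on its own. All of this is done with functions of the network whose value at
  a node depends on a ball around it only; a full information protocol evaluates such a function.
\<close>


section \<open>Hop balls\<close>

text \<open>An SLOCAL algorithm has to be correct for every order of processing, so the simulation
  is free to choose one. Hence no distributed procedure is assembled: for each network one global
  run in a suitable order is fixed, and the work lies in bounding the radius on which its outcome at
  a node depends. The obstacle is that clusters keep changing and need not be connected. Each is
  therefore tied to its label, the identifier of the node where it started: that node may leave or
  die, yet every member stays within a bounded distance of it. A carving step adds the SLOCAL
  locality to this distance, so \<open>b\<close> phases of \<open>T\<close> steps give a radius of
  \<open>b * T\<close> times the locality. \<open>T\<close> is such that a cluster growing in every
  step of a phase would outgrow the network, and logarithmically many bits \<open>b\<close> suffice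
  because identifiers are polynomially bounded.\<close>

lemma hop_ball_0 [simp]: "hop_ball G 0 v = {v}"
  by (auto simp: hop_ball_def)

lemma centre_in_hop_ball [simp]: "v \<in> hop_ball G r v"
  by (auto simp: hop_ball_def intro!: exI[of _ 0])

lemma hop_ball_mono: "r \<le> s \<Longrightarrow> u \<in> hop_ball G r v \<Longrightarrow> u \<in> hop_ball G s v"
  by (auto simp: hop_ball_def intro: order_trans)

lemma hop_ball_trans:
  assumes "u \<in> hop_ball G r v" and "w \<in> hop_ball G s u"
  shows "w \<in> hop_ball G (r + s) v"
proof -
  from assms obtain i j where "i \<le> r" "(v, u) \<in> parcs G ^^ i" "j \<le> s" "(u, w) \<in> parcs G ^^ j"
    by (auto simp: hop_ball_def)
  then have "(v, w) \<in> parcs G ^^ (i + j)" "i + j \<le> r + s"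
    by (auto simp: relpow_add)
  then show ?thesis by (auto simp: hop_ball_def)
qed

lemma hop_ball_Suc:
  "hop_ball G (Suc r) v = insert v (\<Union>u\<in>neighbours G v. hop_ball G r u)" (is "?L = ?R")
proof
  show "?L \<subseteq> ?R"
  proof
    fix w assume "w \<in> ?L"
    then obtain i where i: "i \<le> Suc r" "(v, w) \<in> parcs G ^^ i" by (auto simp: hop_ball_def)
    show "w \<in> ?R"
    proof (cases i)
      case 0
      then show ?thesis using i by simp
    next
      case (Suc j)
      then show ?thesis using i relpow_Suc_D2[of v w j "parcs G"]
        by (auto simp: hop_ball_def neighbours_def)
    qed
  qed
  have "u \<in> hop_ball G 1 v" if "u \<in> neighbours G v" for u
    using that by (auto simp: hop_ball_def neighbours_def intro!: exI[of _ 1])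
  then show "?R \<subseteq> ?L"
    using hop_ball_trans[of _ G 1 v _ r] by auto
qed

lemma networkD:
  assumes "network c G"
  shows "finite (pverts G)" and "u \<in> neighbours G v \<Longrightarrow> u \<in> pverts G"
    and "u \<in> neighbours G v \<Longrightarrow> v \<in> neighbours G u"
    and "v \<in> pverts G \<Longrightarrow> v < num_nodes G ^ c"
proof -
  from assms interpret pair_graph G by (simp add: network_def)
  show "finite (pverts G)" by (rule pair_finite_verts)
  show "u \<in> neighbours G v \<Longrightarrow> u \<in> pverts G"
    by (auto simp: neighbours_def dest: arc_snd_in_verts)
  show "u \<in> neighbours G v \<Longrightarrow> v \<in> neighbours G u"
    using pair_sym_arcs by (auto simp: neighbours_def symmetric_def sym_def)
  show "v \<in> pverts G \<Longrightarrow> v < num_nodes G ^ c"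
    using assms by (auto simp: network_def)
qed

lemma finite_neighbours: "network c G \<Longrightarrow> finite (neighbours G v)"
  by (meson finite_subset networkD(1,2) subsetI)

lemma hop_ball_sym:
  assumes "network c G"
  shows "u \<in> hop_ball G r v \<longleftrightarrow> v \<in> hop_ball G r u"
proof -
  from assms interpret pair_graph G by (simp add: network_def)
  have "(u, v) \<in> parcs G ^^ i" if "(v, u) \<in> parcs G ^^ i" for i u v
    using that
  proof (induction i arbitrary: u)
    case (Suc i)
    then obtain w where "(v, w) \<in> parcs G ^^ i" "(w, u) \<in> parcs G" by auto
    moreover from this have "(u, w) \<in> parcs G"
      using pair_sym_arcs by (auto simp: symmetric_def dest: symD)
    ultimately show ?case using Suc.IH relpow_Suc_I2 by metis
  qed simp
  then show ?thesis by (auto simp: hop_ball_def)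
qed

lemma hop_ball_verts:
  assumes "network c G" and "v \<in> pverts G" and "u \<in> hop_ball G r v"
  shows "u \<in> pverts G"
  using assms(2,3)
proof (induction r arbitrary: v)
  case (Suc r)
  then show ?case using networkD(2)[OF assms(1)] by (auto simp: hop_ball_Suc)
qed simp

text \<open>Complete neighbourhoods are compared, including edges that leave the ball: this is what
  a node knows after \<open>r + 1\<close> rounds. The ball is taken in \<open>G\<close> only, but
  \<open>hop_ball_cong\<close> shows that it is the same in \<open>G'\<close>.\<close>

definition agree :: "nat \<Rightarrow> graph \<Rightarrow> graph \<Rightarrow> nat \<Rightarrow> bool" where
  "agree r G G' v \<longleftrightarrow> (\<forall>u\<in>hop_ball G r v. neighbours G u = neighbours G' u)"

lemma agree_subball:
  "agree r G G' v \<Longrightarrow> u \<in> hop_ball G s v \<Longrightarrow> s + t \<le> r \<Longrightarrow> agree t G G' u"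
  by (meson agree_def hop_ball_mono hop_ball_trans)

lemma agree_mono: "agree r G G' v \<Longrightarrow> t \<le> r \<Longrightarrow> agree t G G' v"
  by (meson agree_def hop_ball_mono)

lemma hop_ball_cong:
  assumes "agree r G G' v"
  shows "hop_ball G r v = hop_ball G' r v"
  using assms
proof (induction r arbitrary: v)
  case (Suc r)
  have nb: "neighbours G v = neighbours G' v"
    using Suc.prems by (simp add: agree_def)
  have "hop_ball G r u = hop_ball G' r u" if "u \<in> neighbours G v" for u
  proof (rule Suc.IH, unfold agree_def, intro ballI)
    fix w assume "w \<in> hop_ball G r u"
    then have "w \<in> hop_ball G (Suc r) v" using that by (auto simp: hop_ball_Suc)
    then show "neighbours G w = neighbours G' w" using Suc.prems by (simp add: agree_def)
  qed
  then show ?case by (simp add: hop_ball_Suc nb)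
qed simp

lemma hop_ball_cong_le: "agree r G G' v \<Longrightarrow> s \<le> r \<Longrightarrow> hop_ball G s v = hop_ball G' s v"
  by (meson agree_mono hop_ball_cong)


section \<open>Full information protocols\<close>

text \<open>All that a node can learn in \<open>t\<close> rounds, as one number. The number of nodes
  is repeated at every level so that it can be extracted without knowing \<open>t\<close>, although
  the second component changes its meaning after level 0.\<close>

fun knowledge :: "graph \<Rightarrow> (nat \<rightharpoonup> nat) \<Rightarrow> nat \<Rightarrow> nat \<Rightarrow> nat" where
  "knowledge G x 0 v = prod_encode (num_nodes G, prod_encode (v, the (x v)))"
| "knowledge G x (Suc t) v =
     prod_encode (num_nodes G, prod_encode (knowledge G x t v,
       set_encode ((\<lambda>u. prod_encode (u, knowledge G x t u)) ` neighbours G v)))"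

definition full_information ::
  "(nat \<Rightarrow> nat) \<Rightarrow> (nat \<Rightarrow> 'o) \<Rightarrow> (nat, 'o) local_alg" where
  "full_information T res =
     \<lparr> rounds = T,
       init = (\<lambda>n v i. prod_encode (n, prod_encode (v, i))),
       send = (\<lambda>s u. s),
       receive = (\<lambda>s m. prod_encode (fst (prod_decode s), prod_encode (s,
         set_encode (prod_encode ` {(u, a). m u = Some a})))),
       result = res \<rparr>"

lemma full_information_sel:
  "rounds (full_information T res) = T"
  "init (full_information T res) n v i = prod_encode (n, prod_encode (v, i))"
  "send (full_information T res) s u = s"
  "receive (full_information T res) s m = prod_encode (fst (prod_decode s), prod_encode (s,
     set_encode (prod_encode ` {(u, a). m u = Some a})))"
  "result (full_information T res) = res"
  by (simp_all add: full_information_def)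

lemma fst_knowledge: "fst (prod_decode (knowledge G x t v)) = num_nodes G"
  by (cases t) simp_all

lemma local_state_full_information:
  "local_state (full_information T res) G x t v = knowledge G x t v"
proof (induction t arbitrary: v)
  case (Suc t)
  have "{(u, a). (if u \<in> neighbours G v then Some (knowledge G x t u) else None) = Some a} =
        (\<lambda>u. (u, knowledge G x t u)) ` neighbours G v"
    by (auto split: if_splits)
  then show ?case
    using Suc by (simp add: full_information_sel fst_knowledge image_image cong: if_cong)
qed (simp add: full_information_sel)

text \<open>The codes are injective, so equal knowledge can be peeled off by one round, even in two
  different networks. Since messages are stored with the identifiers of their senders, the
  neighbourhoods coincide as sets.\<close>

lemma knowledge_step:
  assumes "network c G" and "network c' G'" and "knowledge G x (Suc t) v = knowledge G' x' (Suc t) v'"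
  shows "knowledge G x t v = knowledge G' x' t v'" and "neighbours G v = neighbours G' v'"
    and "u \<in> neighbours G v \<Longrightarrow> knowledge G x t u = knowledge G' x' t u"
proof -
  define M where "M G x v = (\<lambda>u. prod_encode (u, knowledge G x t u)) ` neighbours G v" for G x v
  from assms(3) have eq: "knowledge G x t v = knowledge G' x' t v'"
      "set_encode (M G x v) = set_encode (M G' x' v')"
    unfolding M_def by auto
  then show "knowledge G x t v = knowledge G' x' t v'" by simp
  \<comment> \<open>\<open>set_encode\<close> is injective on finite sets only.\<close>
  have "finite (M G x v)" "finite (M G' x' v')"
    unfolding M_def using finite_neighbours assms(1,2) by blast+
  with eq(2) have "M G x v = M G' x' v'" by (simp add: set_encode_eq)
  then have "prod_encode (u, a) \<in> M G x v \<longleftrightarrow> prod_encode (u, a) \<in> M G' x' v'" for u a by simp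
  then have *: "u \<in> neighbours G v \<and> a = knowledge G x t u \<longleftrightarrow>
      u \<in> neighbours G' v' \<and> a = knowledge G' x' t u" for u a
    by (auto simp: M_def image_iff)
  then show "neighbours G v = neighbours G' v'" by blast
  show "u \<in> neighbours G v \<Longrightarrow> knowledge G x t u = knowledge G' x' t u" using * by blast
qed

lemma knowledge_centre:
  assumes "network c G" and "network c' G'" and "knowledge G x t v = knowledge G' x' t v'"
  shows "v = v' \<and> the (x v) = the (x' v')"
  using assms(3)
proof (induction t)
  case (Suc t)
  then show ?case using knowledge_step(1)[OF assms(1,2)] by metis
qed auto

text \<open>The neighbourhood of a node becomes known to others one round later than its identifier
  and input, hence the strict inequality \<open>r < t\<close>.\<close>

lemma knowledge_ball:
  assumes "network c G" and "network c' G'" and "knowledge G x t v = knowledge G' x' t v"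
    and "u \<in> hop_ball G r v" and "r < t"
  shows "neighbours G u = neighbours G' u \<and> the (x u) = the (x' u)"
  using assms(3-5)
proof (induction r arbitrary: t v)
  case 0
  then obtain s where "t = Suc s" by (cases t) auto
  with 0 show ?case
    using knowledge_step(2)[OF assms(1,2)] knowledge_centre[OF assms(1,2)]
    by (metis hop_ball_0 singletonD)
next
  case (Suc r)
  then obtain s where s: "t = Suc s" "r < s" by (cases t) auto
  consider "u = v" | w where "w \<in> neighbours G v" "u \<in> hop_ball G r w"
    using Suc.prems(2) by (auto simp: hop_ball_Suc)
  then show ?case
  proof cases
    case 1
    then show ?thesis
      using Suc.prems(1) knowledge_step(2)[OF assms(1,2)] knowledge_centre[OF assms(1,2)] s(1)
      by metis
  next
    case 2
    then show ?thesis
      using Suc.IH s knowledge_step(3)[OF assms(1,2)] Suc.prems(1) by metis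
  qed
qed

text \<open>
  A node that knows its ball may guess any instance consistent with it: locality makes the guess
  irrelevant.
\<close>

lemma local_alg_of_local_function:
  fixes Q :: "(nat, 'o) problem"
  assumes sol: "\<And>G x. valid_input Q c G x \<Longrightarrow>
        is_solution Q G x (\<lambda>v. if v \<in> pverts G then Some (f G x v) else None)"
    and loc: "\<And>G x G' x' v. valid_input Q c G x \<Longrightarrow> valid_input Q c G' x' \<Longrightarrow>
        num_nodes G' = num_nodes G \<Longrightarrow> v \<in> pverts G \<Longrightarrow> v \<in> pverts G' \<Longrightarrow>
        agree (R (num_nodes G)) G G' v \<Longrightarrow>
        (\<And>u. u \<in> hop_ball G (R (num_nodes G)) v \<Longrightarrow> x u = x' u) \<Longrightarrow> f G x v = f G' x' v"
  shows "\<exists>A. rounds A = (\<lambda>n. Suc (R n)) \<and> local_solves c A Q"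
proof -
  define run where "run G x v = knowledge G x (Suc (R (num_nodes G))) v" for G x v
  define res where
    "res s = (SOME y. \<exists>G x v. valid_input Q c G x \<and> v \<in> pverts G \<and> run G x v = s \<and> y = f G x v)" for s
  define A where "A = full_information (\<lambda>n. Suc (R n)) res"
  have res: "res (run G x v) = f G x v" if vi: "valid_input Q c G x" and v: "v \<in> pverts G" for G x v
  proof -
    let ?P = "\<lambda>y. \<exists>G' x' v'. valid_input Q c G' x' \<and> v' \<in> pverts G' \<and>
      run G' x' v' = run G x v \<and> y = f G' x' v'"
    have "?P (f G x v)" using vi v by blast
    then have "?P (res (run G x v))" unfolding res_def by (rule someI[of ?P])
    then obtain G' x' v' where *: "valid_input Q c G' x'" "v' \<in> pverts G'"
        "run G' x' v' = run G x v" "res (run G x v) = f G' x' v'"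
      by blast
    have nw: "network c G" "network c G'" and dom: "dom x = pverts G" "dom x' = pverts G'"
      using vi *(1) by (auto simp: valid_input_def)
    have n: "num_nodes G' = num_nodes G"
      using *(3) fst_knowledge unfolding run_def by metis
    define t where "t = R (num_nodes G)"
    have kn: "knowledge G x (Suc t) v = knowledge G' x' (Suc t) v'"
      using *(3) by (simp add: run_def n t_def)
    have v': "v' = v" using knowledge_centre[OF nw kn] by simp
    note ball = knowledge_ball[OF nw kn[unfolded v']]
    have ag: "agree t G G' v" using ball by (auto simp: agree_def)
    \<comment> \<open>\<open>knowledge\<close> records only \<open>the (x u)\<close>; this
      determines \<open>x u\<close> because both inputs are defined on exactly the nodes of their
      networks.\<close>
    have "x u = x' u" if u: "u \<in> hop_ball G t v" for u
    proof -
      have "u \<in> hop_ball G' t v" using u hop_ball_cong[OF ag] by simp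
      then have "u \<in> dom x" "u \<in> dom x'"
        using hop_ball_verts nw u v *(2) v' dom by metis+
      then show ?thesis using ball[OF u] by auto
    qed
    then show ?thesis using loc[OF vi *(1) n v] *(2,4) ag v' by (simp add: t_def)
  qed
  have "rounds A = (\<lambda>n. Suc (R n))" by (simp add: A_def full_information_sel)
  moreover have "local_solves c A Q"
    unfolding local_solves_def
  proof (intro allI impI)
    fix G x assume vi: "valid_input Q c G x"
    have "local_output A G x = (\<lambda>v. if v \<in> pverts G then Some (f G x v) else None)"
      using res[OF vi] unfolding local_output_def A_def local_state_full_information
        full_information_sel run_def by (simp add: fun_eq_iff del: knowledge.simps)
    then show "is_solution Q G x (local_output A G x)" using sol[OF vi] by simp
  qed
  ultimately show ?thesis by blast
qed


section \<open>Ball carving\<close>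

definition cluster :: "(nat \<rightharpoonup> nat) \<Rightarrow> nat \<Rightarrow> nat set" where
  "cluster lab a = {u. lab u = Some a}"

definition red :: "(nat \<rightharpoonup> nat) \<Rightarrow> nat \<Rightarrow> nat \<Rightarrow> bool" where
  "red lab i w \<longleftrightarrow> (\<exists>a. lab w = Some a \<and> bit a i)"

definition contacts :: "(nat \<Rightarrow> nat set) \<Rightarrow> (nat \<rightharpoonup> nat) \<Rightarrow> nat \<Rightarrow> nat \<Rightarrow> nat set" where
  "contacts N lab i w = {a. \<not> bit a i \<and> (\<exists>u\<in>N w. lab u = Some a)}"

definition proposers :: "(nat \<Rightarrow> nat set) \<Rightarrow> (nat \<rightharpoonup> nat) \<Rightarrow> nat \<Rightarrow> nat \<Rightarrow> nat set" where
  "proposers N lab i a =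
     {w. red lab i w \<and> contacts N lab i w \<noteq> {} \<and> a = (LEAST a. a \<in> contacts N lab i w)}"

definition accepts :: "(nat \<Rightarrow> nat set) \<Rightarrow> nat \<Rightarrow> nat \<Rightarrow> (nat \<rightharpoonup> nat) \<Rightarrow> nat \<Rightarrow> bool" where
  "accepts N K i lab a \<longleftrightarrow> card (cluster lab a) \<le> K * card (proposers N lab i a)"

text \<open>
  In phase \<open>i\<close> a label is red or blue according to its bit \<open>i\<close>. A red node next to a blue cluster
  proposes to join it (ties are broken by the least label). The blue cluster accepts if this makes it
  grow by the factor \<open>1 + 1 / K\<close>; otherwise its proposers die, that is, they lose their label.
\<close>

definition carve_step :: "(nat \<Rightarrow> nat set) \<Rightarrow> nat \<Rightarrow> nat \<Rightarrow> (nat \<rightharpoonup> nat) \<Rightarrow> (nat \<rightharpoonup> nat)" where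
  "carve_step N K i lab w =
     (if red lab i w \<and> contacts N lab i w \<noteq> {}
      then let a = LEAST a. a \<in> contacts N lab i w in if accepts N K i lab a then Some a else None
      else lab w)"

primrec carve ::
  "(nat \<Rightarrow> nat set) \<Rightarrow> nat \<Rightarrow> nat \<Rightarrow> nat \<Rightarrow> (nat \<rightharpoonup> nat) \<Rightarrow> (nat \<rightharpoonup> nat)" where
  "carve N K T 0 lab = lab"
| "carve N K T (Suc b) lab = (carve_step N K b ^^ T) (carve N K T b lab)"

definition growing :: "(nat \<Rightarrow> nat set) \<Rightarrow> nat \<Rightarrow> (nat \<rightharpoonup> nat) \<Rightarrow> nat \<Rightarrow> bool" where
  "growing N i lab a \<longleftrightarrow> (\<exists>u\<in>cluster lab a. \<exists>w\<in>N u. red lab i w)"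

text \<open>The potential that pays for the killed nodes. A cluster enters this set at the latest
  when it rejects its proposers, and it stays there during the phase, as steps create no new red
  neighbours for it.\<close>

definition finished :: "(nat \<Rightarrow> nat set) \<Rightarrow> nat \<Rightarrow> (nat \<rightharpoonup> nat) \<Rightarrow> nat set" where
  "finished N i lab = {v. \<exists>a. lab v = Some a \<and> \<not> bit a i \<and> \<not> growing N i lab a}"

text \<open>The invariant of the carving. \<open>take_bit i\<close> keeps the \<open>i\<close>
  low-order bits, which are those of the phases already done.\<close>

definition prefix_separated :: "(nat \<Rightarrow> nat set) \<Rightarrow> nat \<Rightarrow> (nat \<rightharpoonup> nat) \<Rightarrow> bool" where
  "prefix_separated N i lab \<longleftrightarrow>
     (\<forall>u v a b. v \<in> N u \<longrightarrow> lab u = Some a \<longrightarrow> lab v = Some b \<longrightarrow> take_bit i a = take_bit i b)"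

section \<open>Effect of a single carving step\<close>

lemma proposersD:
  assumes "w \<in> proposers N lab i a"
  shows "red lab i w" and "a \<in> contacts N lab i w" and "\<not> bit a i"
    and "\<exists>u\<in>N w. lab u = Some a"
proof -
  show "red lab i w" using assms by (simp add: proposers_def)
  show "a \<in> contacts N lab i w" using assms by (auto simp: proposers_def intro: LeastI)
  then show "\<not> bit a i" and "\<exists>u\<in>N w. lab u = Some a" by (auto simp: contacts_def)
qed

lemma proposers_unique: "w \<in> proposers N lab i a \<Longrightarrow> w \<in> proposers N lab i b \<Longrightarrow> a = b"
  by (simp add: proposers_def)

lemma carve_step_cases:
  obtains (keep) "\<And>a. w \<notin> proposers N lab i a" "carve_step N K i lab w = lab w"
  | (join) a where "w \<in> proposers N lab i a" "accepts N K i lab a" "carve_step N K i lab w = Some a"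
  | (die) a where "w \<in> proposers N lab i a" "\<not> accepts N K i lab a" "carve_step N K i lab w = None"
proof (cases "red lab i w \<and> contacts N lab i w \<noteq> {}")
  case True
  define a where "a = (LEAST a. a \<in> contacts N lab i w)"
  have "w \<in> proposers N lab i a" using True by (simp add: proposers_def a_def)
  then show ?thesis
    using that(2,3)[of a] True by (cases "accepts N K i lab a") (simp_all add: carve_step_def a_def Let_def)
next
  case False
  then show ?thesis using that(1) by (auto simp: proposers_def carve_step_def)
qed

lemma carve_step_proposer:
  "w \<in> proposers N lab i a \<Longrightarrow>
     carve_step N K i lab w = (if accepts N K i lab a then Some a else None)"
  by (cases rule: carve_step_cases[where w = w and N = N and lab = lab and i = i and K = K])
    (auto dest: proposers_unique)

lemma carve_step_blue: "lab w = Some a \<Longrightarrow> \<not> bit a i \<Longrightarrow> carve_step N K i lab w = Some a"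
  by (simp add: carve_step_def red_def)

lemma carve_step_SomeD:
  assumes "carve_step N K i lab w = Some a"
  shows "lab w = Some a \<or> w \<in> proposers N lab i a \<and> accepts N K i lab a"
  using assms by (cases rule: carve_step_cases[where w = w and N = N and lab = lab and i = i and K = K]) auto

text \<open>Every red node with a contact proposes, and a proposer turns blue or dies; blue nodes
  never turn red.\<close>

lemma red_carve_stepD:
  assumes "red (carve_step N K i lab) i w"
  shows "red lab i w" and "contacts N lab i w = {}"
proof -
  from assms obtain a where a: "carve_step N K i lab w = Some a" "bit a i"
    by (auto simp: red_def)
  have "w \<notin> proposers N lab i b" for b
    using a proposersD(3)[of w N lab i] by (auto simp: carve_step_proposer split: if_splits)
  moreover from this have "lab w = Some a" using carve_step_SomeD[OF a(1)] by blast
  ultimately show "red lab i w" and "contacts N lab i w = {}"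
    using a(2) by (auto simp: red_def proposers_def)
qed

lemma dom_carve_step: "dom (carve_step N K i lab) \<subseteq> dom lab"
  by (auto dest!: carve_step_SomeD proposersD(1) simp: red_def)

lemma dom_carve_steps: "dom ((carve_step N K i ^^ t) lab) \<subseteq> dom lab"
proof (induction t)
  case (Suc t)
  then show ?case using dom_carve_step[of N K i "(carve_step N K i ^^ t) lab"] by simp
qed simp

lemma cluster_carve_step:
  assumes "\<not> bit a i"
  shows "cluster (carve_step N K i lab) a =
           cluster lab a \<union> (if accepts N K i lab a then proposers N lab i a else {})"
  using assms
  by (auto simp: cluster_def carve_step_blue carve_step_proposer dest: carve_step_SomeD)

lemma cluster_subset_dom: "cluster lab a \<subseteq> dom lab"
  by (auto simp: cluster_def)

lemma proposers_subset_dom: "proposers N lab i a \<subseteq> dom lab"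
  by (auto dest!: proposersD(1) simp: red_def)

text \<open>A red neighbour left after the step had no blue contact before it, so it touches a new
  member of the cluster. Hence the cluster has accepted, and this new member was itself a red
  neighbour before.\<close>

lemma growing_carve_stepD:
  assumes sym: "\<And>u v. u \<in> N v \<Longrightarrow> v \<in> N u"
    and a: "\<not> bit a i" and gr: "growing N i (carve_step N K i lab) a"
  shows "accepts N K i lab a" and "growing N i lab a"
proof -
  let ?lab = "carve_step N K i lab"
  from gr obtain u w where u: "u \<in> cluster ?lab a" and w: "w \<in> N u" "red ?lab i w"
    by (auto simp: growing_def)
  have "u \<notin> cluster lab a"
    using red_carve_stepD(2)[OF w(2)] sym[OF w(1)] a by (auto simp: contacts_def cluster_def)
  with u have "accepts N K i lab a" "u \<in> proposers N lab i a"
    by (auto simp: cluster_carve_step[OF a] split: if_splits)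
  then show "accepts N K i lab a" and "growing N i lab a"
    using proposersD(1,4)[of u N lab i a] sym unfolding growing_def cluster_def by blast+
qed

text \<open>
  The nodes killed by a cluster are charged to its members. A rejecting cluster has no red neighbour
  left afterwards, so it is charged only once per phase.
\<close>

lemma carve_step_kills:
  assumes sym: "\<And>u v. u \<in> N v \<Longrightarrow> v \<in> N u" and fin: "finite (dom lab)"
  shows "K * card (dom lab - dom (carve_step N K i lab)) + card (finished N i lab)
           \<le> card (finished N i (carve_step N K i lab))"
proof -
  let ?lab = "carve_step N K i lab"
  define R where "R = {a. \<not> accepts N K i lab a \<and> proposers N lab i a \<noteq> {}}"
  have "R \<subseteq> (\<lambda>w. LEAST a. a \<in> contacts N lab i w) ` dom lab"
    using proposers_subset_dom by (fastforce simp: R_def proposers_def)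
  then have finR: "finite R" using fin finite_surj by blast
  have finP: "finite (proposers N lab i a)" and finC: "finite (cluster lab a)" for a
    using fin proposers_subset_dom cluster_subset_dom finite_subset by metis+
  have "dom lab - dom ?lab \<subseteq> (\<Union>a\<in>R. proposers N lab i a)"
  proof
    fix w assume "w \<in> dom lab - dom ?lab"
    then show "w \<in> (\<Union>a\<in>R. proposers N lab i a)"
      by (cases rule: carve_step_cases[where w = w and N = N and lab = lab and i = i and K = K])
        (auto simp: R_def)
  qed
  then have "card (dom lab - dom ?lab) \<le> (\<Sum>a\<in>R. card (proposers N lab i a))"
    using card_UN_le[OF finR, of "proposers N lab i"] finR finP
    by (meson card_mono finite_UN_I le_trans)
  then have "K * card (dom lab - dom ?lab) \<le> (\<Sum>a\<in>R. K * card (proposers N lab i a))"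
    by (simp flip: sum_distrib_left)
  also have "\<dots> \<le> (\<Sum>a\<in>R. card (cluster lab a))"
    by (intro sum_mono) (auto simp: R_def accepts_def)
  also have "\<dots> = card (\<Union>a\<in>R. cluster lab a)"
    using finR finC by (subst card_UN_disjoint) (auto simp: cluster_def)
  finally have 1: "K * card (dom lab - dom ?lab) \<le> card (\<Union>a\<in>R. cluster lab a)" .
  \<comment> \<open>Having a proposer means having a red neighbour, so the members of rejecting
    clusters were not \<open>finished\<close> before the step: nobody is charged twice.\<close>
  have blue: "\<not> bit a i" and "growing N i lab a" if "a \<in> R" for a
  proof -
    from that obtain w where w: "w \<in> proposers N lab i a" by (auto simp: R_def)
    show "\<not> bit a i" using proposersD(3)[OF w] .
    show "growing N i lab a"
      using proposersD(1,4)[OF w] sym unfolding growing_def cluster_def by blast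
  qed
  then have "(\<Union>a\<in>R. cluster lab a) \<inter> finished N i lab = {}"
    by (auto simp: cluster_def finished_def)
  then have 2: "card ((\<Union>a\<in>R. cluster lab a) \<union> finished N i lab) =
      card (\<Union>a\<in>R. cluster lab a) + card (finished N i lab)"
    using finR finC fin
    by (intro card_Un_disjoint) (auto simp: finished_def intro: finite_subset[of _ "dom lab"])
  have "(\<Union>a\<in>R. cluster lab a) \<union> finished N i lab \<subseteq> finished N i ?lab"
  proof
    fix v assume "v \<in> (\<Union>a\<in>R. cluster lab a) \<union> finished N i lab"
    then obtain a where a: "lab v = Some a" "\<not> bit a i" "\<not> accepts N K i lab a \<or> \<not> growing N i lab a"
      using blue by (auto simp: R_def finished_def cluster_def)
    moreover from a have "\<not> growing N i ?lab a"
      using growing_carve_stepD[where N = N and K = K, OF sym] by blast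
    ultimately show "v \<in> finished N i ?lab"
      by (auto simp: finished_def carve_step_blue)
  qed
  moreover have "finite (finished N i ?lab)"
    by (rule finite_subset[OF _ fin]) (use dom_carve_step[of N K i lab] in \<open>auto simp: finished_def\<close>)
  ultimately have "card ((\<Union>a\<in>R. cluster lab a) \<union> finished N i lab) \<le> card (finished N i ?lab)"
    by (intro card_mono)
  then show ?thesis using 1 2 by linarith
qed

text \<open>The charges of \<open>carve_step_kills\<close> telescope to the number of finished nodes
  at the end, and these are still labelled.\<close>

lemma carve_steps_kills:
  assumes "\<And>u v. u \<in> N v \<Longrightarrow> v \<in> N u" and fin: "finite (dom lab)"
  shows "K * card (dom lab - dom ((carve_step N K i ^^ t) lab)) \<le> card (dom lab)"
proof -
  let ?l = "\<lambda>t. (carve_step N K i ^^ t) lab"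
  have fin': "finite (dom (?l t))" for t
    using fin dom_carve_steps finite_subset by metis
  have "K * card (dom lab - dom (?l t)) \<le> card (finished N i (?l t))" for t
  proof (induction t)
    case (Suc t)
    have "dom lab - dom (?l (Suc t)) = (dom lab - dom (?l t)) \<union> (dom (?l t) - dom (?l (Suc t)))"
      using dom_carve_steps[where N = N and K = K and i = i and t = t and lab = lab]
        dom_carve_step[of N K i "?l t"] by auto
    then have "card (dom lab - dom (?l (Suc t))) \<le>
        card (dom lab - dom (?l t)) + card (dom (?l t) - dom (?l (Suc t)))"
      by (metis card_Un_le)
    then have "K * card (dom lab - dom (?l (Suc t))) \<le>
        K * card (dom lab - dom (?l t)) + K * card (dom (?l t) - dom (?l (Suc t)))"
      by (metis add_mult_distrib2 mult_le_mono2)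
    also have "\<dots> \<le> card (finished N i (?l (Suc t)))"
      using Suc carve_step_kills[where N = N, OF assms(1) fin', of K t i] by simp
    finally show ?case .
  qed simp
  also have "card (finished N i (?l t)) \<le> card (dom lab)"
    using dom_carve_steps[where N = N and K = K and i = i and t = t and lab = lab]
    by (intro card_mono fin) (auto simp: finished_def)
  finally show ?thesis .
qed

section \<open>Growth of clusters and separation after a phase\<close>

text \<open>A cluster that still has a red neighbour after \<open>t\<close> steps has accepted in
  each of them, so it has at least \<open>(1 + 1 / K) ^ t\<close> members; multiplication by
  \<open>K ^ t\<close> keeps the inequality in the natural numbers.\<close>

lemma carve_steps_growth:
  assumes sym: "\<And>u v. u \<in> N v \<Longrightarrow> v \<in> N u" and fin: "finite (dom lab)" and a: "\<not> bit a i"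
  shows "growing N i ((carve_step N K i ^^ t) lab) a \<Longrightarrow>
    Suc K ^ t \<le> K ^ t * card (cluster ((carve_step N K i ^^ t) lab) a)"
proof (induction t)
  case 0
  have "finite (cluster lab a)" using fin cluster_subset_dom finite_subset by metis
  with 0 show ?case by (auto simp: growing_def card_gt_0_iff Suc_le_eq)
next
  case (Suc t)
  let ?l = "(carve_step N K i ^^ t) lab"
  have fin': "finite (cluster ?l a)" "finite (proposers N ?l i a)"
    using fin dom_carve_steps cluster_subset_dom proposers_subset_dom finite_subset by metis+
  have acc: "accepts N K i ?l a" and gr: "growing N i ?l a"
    using growing_carve_stepD[where N = N and K = K and lab = ?l, OF sym a] Suc.prems by simp_all
  have "cluster ?l a \<inter> proposers N ?l i a = {}"
    using a by (auto simp: cluster_def red_def dest!: proposersD(1))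
  then have "card (cluster (carve_step N K i ?l) a) = card (cluster ?l a) + card (proposers N ?l i a)"
    using acc fin' by (simp add: cluster_carve_step[OF a] card_Un_disjoint)
  then have "Suc K * card (cluster ?l a) \<le> K * card (cluster (carve_step N K i ?l) a)"
    using acc by (simp add: accepts_def algebra_simps)
  then have "K ^ t * (Suc K * card (cluster ?l a)) \<le> K ^ t * (K * card (cluster (carve_step N K i ?l) a))"
    by (rule mult_le_mono2)
  moreover have "Suc K * Suc K ^ t \<le> Suc K * (K ^ t * card (cluster ?l a))"
    using Suc.IH[OF gr] by (rule mult_le_mono2)
  ultimately show ?case by (simp add: algebra_simps)
qed

text \<open>A node adopts only labels seen in its neighbourhood, and these already share their low
  \<open>i\<close> bits with its own. So these bits never change at a node that survives.\<close>

lemma prefix_separated_carve_step: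
  assumes sep: "prefix_separated N i lab"
  shows "prefix_separated N i (carve_step N K i lab)"
proof -
  have old: "\<exists>a'. lab u = Some a' \<and> take_bit i a' = take_bit i a"
    if "carve_step N K i lab u = Some a" for u a
  proof (cases "lab u = Some a")
    case False
    then have p: "u \<in> proposers N lab i a" using carve_step_SomeD[OF that] by blast
    then obtain a' v where "lab u = Some a'" "v \<in> N u" "lab v = Some a"
      using proposersD(1,4)[OF p] by (auto simp: red_def)
    then show ?thesis using sep by (auto simp: prefix_separated_def)
  qed simp
  show ?thesis
    unfolding prefix_separated_def
  proof (intro allI impI)
    fix u v a b assume "v \<in> N u" "carve_step N K i lab u = Some a" "carve_step N K i lab v = Some b"
    with old[of u a] old[of v b] sep show "take_bit i a = take_bit i b"
      by (auto simp: prefix_separated_def)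
  qed
qed

text \<open>A blue cluster still growing after \<open>T\<close> steps would have more members than
  there are labelled nodes. So no blue node has a red neighbour at the end, and the labels of
  neighbours agree in bit \<open>i\<close> as well.\<close>

lemma prefix_separated_phase:
  assumes sym: "\<And>u v. u \<in> N v \<Longrightarrow> v \<in> N u" and fin: "finite (dom lab)"
    and T: "card (dom lab) * K ^ T < Suc K ^ T" and sep: "prefix_separated N i lab"
  shows "prefix_separated N (Suc i) ((carve_step N K i ^^ T) lab)"
proof -
  let ?l = "(carve_step N K i ^^ T) lab"
  have sep': "prefix_separated N i ((carve_step N K i ^^ t) lab)" for t
    by (induction t) (use sep prefix_separated_carve_step in auto)
  have stop: "\<not> growing N i ?l a" if a: "\<not> bit a i" for a
  proof
    assume "growing N i ?l a"
    then have "Suc K ^ T \<le> K ^ T * card (cluster ?l a)"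
      using carve_steps_growth[where N = N, OF sym fin a] by blast
    also have "\<dots> \<le> K ^ T * card (dom lab)"
      using cluster_subset_dom[of ?l a]
        dom_carve_steps[where N = N and K = K and i = i and t = T and lab = lab]
      by (intro mult_le_mono2 card_mono fin) blast
    finally show False using T by (simp add: mult.commute)
  qed
  have "bit a i = bit b i" if "v \<in> N u" "?l u = Some a" "?l v = Some b" for u v a b
    using stop[of a] stop[of b] that sym[OF that(1)] unfolding growing_def cluster_def red_def by blast
  then show ?thesis
    using sep'[of T] by (simp add: prefix_separated_def take_bit_Suc_from_most)
qed

lemma dom_carve: "dom (carve N K T b lab) \<subseteq> dom lab"
proof (induction b)
  case (Suc b)
  then show ?case
    using dom_carve_steps[where N = N and K = K and i = b and t = T and lab = "carve N K T b lab"]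
    by simp
qed simp

lemma carve_kills:
  assumes "\<And>u v. u \<in> N v \<Longrightarrow> v \<in> N u" and fin: "finite (dom lab)"
  shows "K * card (dom lab - dom (carve N K T b lab)) \<le> b * card (dom lab)"
proof (induction b)
  case (Suc b)
  let ?l = "carve N K T b lab" and ?l' = "carve N K T (Suc b) lab"
  have fin': "finite (dom ?l)" using fin dom_carve finite_subset by metis
  have "dom lab - dom ?l' = (dom lab - dom ?l) \<union> (dom ?l - dom ?l')"
    using dom_carve[of N K T b lab]
      dom_carve_steps[where N = N and K = K and i = b and t = T and lab = ?l] by auto
  then have "card (dom lab - dom ?l') \<le> card (dom lab - dom ?l) + card (dom ?l - dom ?l')"
    by (metis card_Un_le)
  then have "K * card (dom lab - dom ?l') \<le> K * card (dom lab - dom ?l) + K * card (dom ?l - dom ?l')"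
    by (metis add_mult_distrib2 mult_le_mono2)
  also have "K * card (dom ?l - dom ?l') \<le> card (dom ?l)"
    using carve_steps_kills[where N = N, OF assms(1) fin', where K = K and i = b and t = T] by simp
  also have "card (dom ?l) \<le> card (dom lab)"
    by (intro card_mono fin dom_carve)
  finally show ?case using Suc by simp
qed simp

text \<open>The origin of \<open>K = 2 * b\<close>: each of the \<open>b\<close> phases loses at
  most the fraction \<open>1 / (2 * b)\<close> of the nodes.\<close>

lemma carve_half:
  assumes "\<And>u v. u \<in> N v \<Longrightarrow> v \<in> N u" and fin: "finite (dom lab)" and "b > 0"
  shows "2 * card (dom lab - dom (carve N (2 * b) T b lab)) \<le> card (dom lab)"
  using carve_kills[where N = N, OF assms(1,2), of "2 * b" T b] \<open>b > 0\<close> by simp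

lemma carve_separated:
  assumes sym: "\<And>u v. u \<in> N v \<Longrightarrow> v \<in> N u" and fin: "finite (dom lab)"
    and T: "card (dom lab) * K ^ T < Suc K ^ T"
  shows "prefix_separated N b (carve N K T b lab)"
proof (induction b)
  case (Suc b)
  let ?l = "carve N K T b lab"
  have "card (dom ?l) * K ^ T \<le> card (dom lab) * K ^ T"
    by (intro mult_le_mono1 card_mono fin dom_carve)
  then show ?case
    using prefix_separated_phase[where N = N and lab = ?l and K = K and T = T and i = b, OF sym]
      Suc T fin dom_carve finite_subset
    by (metis carve.simps(2) le_less_trans)
qed (simp add: prefix_separated_def)


section \<open>Locality of the carving\<close>

text \<open>The number of nodes is fixed, since all radii depend on it and every node knows
  it.\<close>

definition local_fun :: "nat \<Rightarrow> nat \<Rightarrow> nat \<Rightarrow> (graph \<Rightarrow> nat \<Rightarrow> 'a) \<Rightarrow> bool" where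
  "local_fun c n r F \<longleftrightarrow>
     (\<forall>G G' v. network c G \<and> network c G' \<and> num_nodes G = n \<and> num_nodes G' = n \<and>
        v \<in> pverts G \<and> v \<in> pverts G' \<and> agree r G G' v \<longrightarrow> F G v = F G' v)"

text \<open>A weak radius: distances are measured in the whole network, and the node
  \<open>a\<close> that names the cluster need not belong to it any more.\<close>

definition centred :: "nat \<Rightarrow> nat \<Rightarrow> nat \<Rightarrow> (graph \<Rightarrow> nat \<rightharpoonup> nat) \<Rightarrow> bool" where
  "centred c n d F \<longleftrightarrow>
     (\<forall>G v a. network c G \<longrightarrow> num_nodes G = n \<longrightarrow> F G v = Some a \<longrightarrow>
        v \<in> pverts G \<and> a \<in> hop_ball G d v)"

lemma local_fun_mono: "local_fun c n r F \<Longrightarrow> r \<le> s \<Longrightarrow> local_fun c n s F"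
  unfolding local_fun_def by (blast intro: agree_mono)

lemma local_fun_cong:
  assumes "local_fun c n r F" and eq: "\<And>G. num_nodes G = n \<Longrightarrow> F' G = F G"
  shows "local_fun c n r F'"
  unfolding local_fun_def
proof (intro allI impI)
  fix G G' v
  assume *: "network c G \<and> network c G' \<and> num_nodes G = n \<and> num_nodes G' = n \<and>
    v \<in> pverts G \<and> v \<in> pverts G' \<and> agree r G G' v"
  then have "F G v = F G' v" using assms(1) unfolding local_fun_def by blast
  then show "F' G v = F' G' v" using eq * by simp
qed

lemma centred_cong:
  assumes "centred c n d F" and "\<And>G. num_nodes G = n \<Longrightarrow> F' G = F G"
  shows "centred c n d F'"
  using assms by (simp add: centred_def)

text \<open>Members of a cluster are connected via its name: \<open>r\<close> from \<open>v\<close>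
  to a member, \<open>d\<close> on to \<open>a\<close>, and \<open>d\<close> from there to
  \<open>w\<close>.\<close>

lemma cluster_in_ball:
  assumes F: "centred c n d F" and nw: "network c G" "num_nodes G = n"
    and a: "a \<in> contacts (hop_ball G r) (F G) i v" and w: "w \<in> cluster (F G) a"
  shows "w \<in> hop_ball G (r + 2 * d) v"
proof -
  from a obtain u where u: "u \<in> hop_ball G r v" "F G u = Some a" by (auto simp: contacts_def)
  have "a \<in> hop_ball G d u" "a \<in> hop_ball G d w"
    using F nw u(2) w by (auto simp: centred_def cluster_def)
  then have "w \<in> hop_ball G (r + d + d) v"
    using u(1) hop_ball_sym[OF nw(1)] hop_ball_trans by metis
  then show ?thesis by (simp add: mult_2 add.assoc)
qed

lemma proposers_in_ball:
  assumes F: "centred c n d F" and nw: "network c G" "num_nodes G = n"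
    and a: "a \<in> contacts (hop_ball G r) (F G) i v"
    and w: "w \<in> proposers (hop_ball G r) (F G) i a"
  shows "w \<in> hop_ball G (2 * r + 2 * d) v"
proof -
  from proposersD(4)[OF w] obtain u where "u \<in> hop_ball G r w" "u \<in> cluster (F G) a"
    by (auto simp: cluster_def)
  then have "w \<in> hop_ball G ((r + 2 * d) + r) v"
    using cluster_in_ball[OF F nw a] hop_ball_sym[OF nw(1)] hop_ball_trans by metis
  then show ?thesis by (simp add: mult_2 add_ac)
qed

text \<open>The fate of \<open>v\<close> depends on the sizes of the cluster it contacts and of the
  set of proposers of that cluster. Proposers lie within \<open>2 * r + 2 * d\<close>, a further
  \<open>r\<close> reveals the contacts that decide where they propose, and reading a label costs
  \<open>s\<close>.\<close>

lemma local_fun_carve_step: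
  assumes loc: "local_fun c n s F" and F: "centred c n d F"
  shows "local_fun c n (s + (3 * r + 2 * d)) (\<lambda>G. carve_step (hop_ball G r) K i (F G))"
  unfolding local_fun_def
proof (intro allI impI, elim conjE)
  fix G G' v
  assume nw: "network c G" "network c G'" and n: "num_nodes G = n" "num_nodes G' = n"
    and v: "v \<in> pverts G" "v \<in> pverts G'" and ag: "agree (s + (3 * r + 2 * d)) G G' v"
  let ?N = "hop_ball G r" and ?N' = "hop_ball G' r"
  have ball: "hop_ball G t v = hop_ball G' t v" if "t \<le> 3 * r + 2 * d" for t
    using hop_ball_cong_le[OF ag, of t] that by simp
  have lab: "F G u = F G' u" if u: "u \<in> hop_ball G (3 * r + 2 * d) v" for u
  proof -
    have "u \<in> pverts G" "u \<in> pverts G'"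
      using hop_ball_verts[OF nw(1) v(1)] hop_ball_verts[OF nw(2) v(2)] u ball by blast+
    moreover have "agree s G G' u" using agree_subball[OF ag u, of s] by simp
    ultimately show ?thesis using loc nw n by (auto simp: local_fun_def)
  qed
  have con: "contacts ?N (F G) i u = contacts ?N' (F G') i u"
    and red: "red (F G) i u = red (F G') i u" if u: "u \<in> hop_ball G (2 * r + 2 * d) v" for u
  proof -
    have "agree r G G' u" by (rule agree_subball[OF ag u]) simp
    then have "?N u = ?N' u" by (rule hop_ball_cong)
    moreover have "F G w = F G' w" if "w \<in> ?N u" for w
      using lab hop_ball_trans[OF u that] by (simp add: algebra_simps)
    ultimately show "contacts ?N (F G) i u = contacts ?N' (F G') i u"
      by (auto simp: contacts_def)
    have "F G u = F G' u"
      using u by (intro lab) (auto elim: hop_ball_mono[rotated])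
    then show "red (F G) i u = red (F G') i u" by (simp add: red_def)
  qed
  note v0 = centre_in_hop_ball[of v G "2 * r + 2 * d"]
  have acc: "accepts ?N K i (F G) a = accepts ?N' K i (F G') a" if a: "a \<in> contacts ?N (F G) i v" for a
  proof -
    have a': "a \<in> contacts ?N' (F G') i v" using a con[OF v0] by simp
    have "cluster (F G) a = cluster (F G') a"
    proof (rule set_eqI)
      fix w
      have "w \<in> hop_ball G (3 * r + 2 * d) v" if "w \<in> cluster (F G) a \<or> w \<in> cluster (F G') a"
      proof -
        have "w \<in> hop_ball G (r + 2 * d) v"
          using that cluster_in_ball[OF F nw(1) n(1) a] cluster_in_ball[OF F nw(2) n(2) a']
            ball[of "r + 2 * d"] by auto
        then show ?thesis by (rule hop_ball_mono[rotated]) simp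
      qed
      then show "w \<in> cluster (F G) a \<longleftrightarrow> w \<in> cluster (F G') a"
        using lab[of w] by (auto simp: cluster_def)
    qed
    moreover have "proposers ?N (F G) i a = proposers ?N' (F G') i a"
    proof (rule set_eqI)
      fix w
      have w: "w \<in> hop_ball G (2 * r + 2 * d) v"
        if "w \<in> proposers ?N (F G) i a \<or> w \<in> proposers ?N' (F G') i a"
        using that proposers_in_ball[OF F nw(1) n(1) a] proposers_in_ball[OF F nw(2) n(2) a']
          ball[of "2 * r + 2 * d"] by auto
      show "w \<in> proposers ?N (F G) i a \<longleftrightarrow> w \<in> proposers ?N' (F G') i a"
      proof (cases "w \<in> hop_ball G (2 * r + 2 * d) v")
        case True
        then show ?thesis unfolding proposers_def by (simp only: con red mem_Collect_eq)
      qed (use w in blast)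
    qed
    ultimately show ?thesis by (simp add: accepts_def)
  qed
  have Fv: "F G v = F G' v" by (rule lab) simp
  \<comment> \<open>\<open>acc\<close> concerns genuine contacts only, and the least contact is one
    only if there are any.\<close>
  show "carve_step ?N K i (F G) v = carve_step ?N' K i (F G') v"
  proof (cases "contacts ?N (F G) i v = {}")
    case True
    then show ?thesis using con[OF v0] Fv by (simp add: carve_step_def)
  next
    case False
    then have "(LEAST a. a \<in> contacts ?N (F G) i v) \<in> contacts ?N (F G) i v"
      by (auto intro: LeastI)
    from acc[OF this] show ?thesis
      unfolding carve_step_def Let_def con[OF v0, symmetric] red[OF v0, symmetric] Fv by simp
  qed
qed

lemma centred_carve_step:
  assumes F: "centred c n d F"
  shows "centred c n (d + r) (\<lambda>G. carve_step (hop_ball G r) K i (F G))"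
  unfolding centred_def
proof (intro allI impI)
  fix G v a
  assume nw: "network c G" "num_nodes G = n" and a: "carve_step (hop_ball G r) K i (F G) v = Some a"
  from carve_step_SomeD[OF a] show "v \<in> pverts G \<and> a \<in> hop_ball G (d + r) v"
  proof
    assume "F G v = Some a"
    then show ?thesis
      using F nw hop_ball_mono[of d "d + r"] by (auto simp: centred_def)
  next
    assume "v \<in> proposers (hop_ball G r) (F G) i a \<and> accepts (hop_ball G r) K i (F G) a"
    then obtain u b where "u \<in> hop_ball G r v" "F G u = Some a" "F G v = Some b"
      using proposersD(1,4) unfolding red_def by blast
    then show ?thesis
      using F nw hop_ball_trans[of u G r v a d] by (auto simp: centred_def add.commute)
  qed
qed

text \<open>The locality of a step involves the current radius, so both bounds are proved together.
  The common bound \<open>D\<close> makes all steps cost the same and avoids a sum over growing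
  radii.\<close>

lemma carve_steps_local_centred:
  assumes "local_fun c n s F" and "centred c n d F" and "d + t * r \<le> D"
  shows "local_fun c n (s + t * (3 * r + 2 * D)) (\<lambda>G. (carve_step (hop_ball G r) K i ^^ t) (F G)) \<and>
    centred c n (d + t * r) (\<lambda>G. (carve_step (hop_ball G r) K i ^^ t) (F G))"
  using assms(3)
proof (induction t)
  case 0
  then show ?case using assms by simp
next
  case (Suc t)
  let ?F = "\<lambda>G. (carve_step (hop_ball G r) K i ^^ t) (F G)"
  have d: "d + t * r \<le> D" using Suc.prems by simp
  then have *: "local_fun c n (s + t * (3 * r + 2 * D)) ?F" "centred c n (d + t * r) ?F"
    using Suc.IH by auto
  show ?case
    using local_fun_mono[OF local_fun_carve_step[OF *, of r K i], of "s + Suc t * (3 * r + 2 * D)"]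
      centred_carve_step[OF *(2), of r K i] d by (simp add: algebra_simps)
qed

lemma carve_local_centred:
  assumes "local_fun c n s F" and "centred c n 0 F" and "b * T * r \<le> D"
  shows "local_fun c n (s + b * T * (3 * r + 2 * D)) (\<lambda>G. carve (hop_ball G r) K T b (F G)) \<and>
    centred c n (b * T * r) (\<lambda>G. carve (hop_ball G r) K T b (F G))"
  using assms(3)
proof (induction b)
  case 0
  then show ?case using assms by simp
next
  case (Suc b)
  have "b * T * r + T * r \<le> D" using Suc.prems by (simp add: algebra_simps)
  moreover from this have "local_fun c n (s + b * T * (3 * r + 2 * D)) (\<lambda>G. carve (hop_ball G r) K T b (F G))"
    "centred c n (b * T * r) (\<lambda>G. carve (hop_ball G r) K T b (F G))"
    using Suc.IH by auto
  ultimately show ?case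
    using carve_steps_local_centred[of c n "s + b * T * (3 * r + 2 * D)"
        "\<lambda>G. carve (hop_ball G r) K T b (F G)" "b * T * r" T r D K b]
    by (simp add: algebra_simps)
qed


section \<open>Network decomposition\<close>

text \<open>The labelling at the start of a carving: every remaining node forms a cluster of its
  own, named after itself, so the radius starts again at 0.\<close>

definition uncoloured :: "nat set \<Rightarrow> (nat \<rightharpoonup> nat \<times> nat) \<Rightarrow> (nat \<rightharpoonup> nat)" where
  "uncoloured V col v = (if v \<in> V \<and> col v = None then Some v else None)"

text \<open>A value consists of the colour and the name of the cluster. Nodes that died in one
  carving stay uncoloured and take part in the next.\<close>

primrec colouring ::
  "(nat \<Rightarrow> nat set) \<Rightarrow> nat \<Rightarrow> nat \<Rightarrow> nat set \<Rightarrow> nat \<Rightarrow> (nat \<rightharpoonup> nat \<times> nat)" where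
  "colouring N T b V 0 = Map.empty"
| "colouring N T b V (Suc m) =
     (map_option (Pair m) \<circ> carve N (2 * b) T b (uncoloured V (colouring N T b V m)))
       ++ colouring N T b V m"

lemma dom_uncoloured: "dom (uncoloured V col) = V - dom col"
  by (auto simp: uncoloured_def split: if_splits)

lemma colouring_SucE:
  assumes "colouring N T b V (Suc m) v = Some p"
  obtains "colouring N T b V m v = Some p"
  | a where "p = (m, a)" "carve N (2 * b) T b (uncoloured V (colouring N T b V m)) v = Some a"
  using assms by (auto simp: map_add_Some_iff)

lemma colouring_less: "colouring N T b V m v = Some (k, a) \<Longrightarrow> k < m"
  by (induction m) (auto elim!: colouring_SucE)

lemma colouring_separated:
  assumes sym: "\<And>u v. u \<in> N v \<Longrightarrow> v \<in> N u" and fin: "finite V"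
    and T: "card V * (2 * b) ^ T < Suc (2 * b) ^ T" and v: "v \<in> N u"
  shows "colouring N T b V m u = Some (k, a) \<Longrightarrow> colouring N T b V m v = Some (k, a') \<Longrightarrow>
    take_bit b a = take_bit b a'"
proof (induction m)
  case (Suc m)
  let ?lab = "uncoloured V (colouring N T b V m)"
  have "card (dom ?lab) * (2 * b) ^ T \<le> card V * (2 * b) ^ T"
    by (intro mult_le_mono1 card_mono fin) (simp add: dom_uncoloured)
  then have "prefix_separated N b (carve N (2 * b) T b ?lab)"
    using fin by (intro carve_separated[where N = N, OF sym] le_less_trans[OF _ T])
      (simp_all add: dom_uncoloured)
  then have sep: "take_bit b a = take_bit b a'"
    if "carve N (2 * b) T b ?lab u = Some a" "carve N (2 * b) T b ?lab v = Some a'"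
    using that v unfolding prefix_separated_def by blast
  show ?case
  proof (cases "k = m")
    case True
    then have "colouring N T b V m u \<noteq> Some (k, a)" "colouring N T b V m v \<noteq> Some (k, a')"
      using colouring_less[of N T b V m] by auto
    then show ?thesis using Suc.prems sep by (auto elim!: colouring_SucE)
  next
    case False
    then have "colouring N T b V m u = Some (k, a)" "colouring N T b V m v = Some (k, a')"
      using Suc.prems by (auto elim!: colouring_SucE)
    then show ?thesis by (rule Suc.IH)
  qed
qed simp

text \<open>At most half of the remaining nodes die in each carving, so after \<open>m\<close>
  rounds fewer than one is left.\<close>

lemma colouring_total:
  assumes sym: "\<And>u v. u \<in> N v \<Longrightarrow> v \<in> N u" and fin: "finite V" and b: "b > 0"
    and card: "card V < 2 ^ m"
  shows "V \<subseteq> dom (colouring N T b V m)"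
proof -
  have "2 ^ m * card (V - dom (colouring N T b V m)) \<le> card V" for m
  proof (induction m)
    case (Suc m)
    let ?col = "colouring N T b V"
    let ?lab = "uncoloured V (?col m)"
    have "2 * card (dom ?lab - dom (carve N (2 * b) T b ?lab)) \<le> card (dom ?lab)"
      using fin b by (intro carve_half[where N = N, OF sym]) (auto simp: dom_uncoloured)
    moreover have "V - dom (?col (Suc m)) = dom ?lab - dom (carve N (2 * b) T b ?lab)"
      by (auto simp: dom_uncoloured)
    ultimately have "2 * card (V - dom (?col (Suc m))) \<le> card (V - dom (?col m))"
      by (simp add: dom_uncoloured)
    then have "2 ^ m * (2 * card (V - dom (?col (Suc m)))) \<le> 2 ^ m * card (V - dom (?col m))"
      by (rule mult_le_mono2)
    then show ?case
      unfolding power_Suc mult.assoc mult.left_commute[of 2] using Suc by (rule le_trans)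
  qed simp
  then have "2 ^ m * card (V - dom (colouring N T b V m)) < 2 ^ m"
    using card le_less_trans by blast
  then show ?thesis using fin by auto
qed

text \<open>Locality adds up over the colours, as one has to know which nodes the previous ones left
  over. The cluster radius \<open>D\<close> does not, as each colour starts from singletons.\<close>

lemma colouring_local_centred:
  fixes r T b :: nat
  defines "D \<equiv> b * T * r"
  defines "col \<equiv> \<lambda>m G. colouring (hop_ball G r) T b (pverts G) m"
  shows "local_fun c n (m * (b * T * (3 * r + 2 * D))) (col m) \<and>
    centred c n D (\<lambda>G. map_option snd \<circ> col m G)"
proof (induction m)
  case 0
  then show ?case by (simp add: local_fun_def centred_def col_def)
next
  case (Suc m)
  let ?M = "b * T * (3 * r + 2 * D)"
  let ?F = "\<lambda>G. uncoloured (pverts G) (col m G)"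
  have F: "local_fun c n (m * ?M) ?F"
    unfolding local_fun_def
  proof (intro allI impI, elim conjE)
    fix G G' v
    assume "network c G" "network c G'" "num_nodes G = n" "num_nodes G' = n"
      "v \<in> pverts G" "v \<in> pverts G'" "agree (m * ?M) G G' v"
    moreover from this have "col m G v = col m G' v" using Suc by (auto simp: local_fun_def)
    ultimately show "?F G v = ?F G' v" by (simp add: uncoloured_def)
  qed
  have "centred c n 0 ?F" by (auto simp: centred_def uncoloured_def split: if_splits)
  from carve_local_centred[OF F this, of b T r D "2 * b"]
  have carve: "local_fun c n (Suc m * ?M) (\<lambda>G. carve (hop_ball G r) (2 * b) T b (?F G))"
    "centred c n D (\<lambda>G. carve (hop_ball G r) (2 * b) T b (?F G))"
    by (simp_all add: D_def algebra_simps)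
  have col: "local_fun c n (Suc m * ?M) (col m)"
    using Suc local_fun_mono[of c n "m * ?M" "col m" "Suc m * ?M"] by auto
  have "local_fun c n (Suc m * ?M) (col (Suc m))"
    unfolding local_fun_def
  proof (intro allI impI, elim conjE)
    fix G G' v
    assume *: "network c G" "network c G'" "num_nodes G = n" "num_nodes G' = n"
      "v \<in> pverts G" "v \<in> pverts G'" "agree (Suc m * ?M) G G' v"
    have "col m G v = col m G' v" using col * unfolding local_fun_def by blast
    moreover have "carve (hop_ball G r) (2 * b) T b (?F G) v = carve (hop_ball G' r) (2 * b) T b (?F G') v"
      using carve(1) * unfolding local_fun_def by blast
    ultimately show "col (Suc m) G v = col (Suc m) G' v"
      by (simp add: col_def map_add_def split: option.split)
  qed
  moreover have "centred c n D (\<lambda>G. map_option snd \<circ> col (Suc m) G)"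
    unfolding centred_def
  proof (intro allI impI)
    fix G v a
    assume nw: "network c G" "num_nodes G = n" and "(map_option snd \<circ> col (Suc m) G) v = Some a"
    then obtain k where "colouring (hop_ball G r) T b (pverts G) (Suc m) v = Some (k, a)"
      by (force simp: col_def simp del: colouring.simps)
    then show "v \<in> pverts G \<and> a \<in> hop_ball G D v"
    proof (cases rule: colouring_SucE)
      case 1
      then have "(map_option snd \<circ> col m G) v = Some a" by (simp add: col_def)
      then show ?thesis using Suc nw unfolding centred_def by blast
    next
      case (2 a')
      then show ?thesis using carve(2) nw by (auto simp: centred_def col_def)
    qed
  qed
  ultimately show ?case by blast
qed


section \<open>Simulating an SLOCAL algorithm\<close>

definition slocal_run ::
  "('i, 'o) slocal_alg \<Rightarrow> graph \<Rightarrow> (nat \<rightharpoonup> 'i) \<Rightarrow> nat list \<Rightarrow> (nat \<rightharpoonup> nat \<times> 'o)" where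
  "slocal_run A G x vs = fold (slocal_step A G x) vs Map.empty"

lemma fold_slocal_step_other:
  "v \<notin> set vs \<Longrightarrow> fold (slocal_step A G x) vs s v = s v"
  by (induction vs arbitrary: s) (auto simp: slocal_step_def)

lemma dom_slocal_run: "dom (slocal_run A G x vs) = set vs"
proof -
  have "dom (fold (slocal_step A G x) vs s) = dom s \<union> set vs" for s
    by (induction vs arbitrary: s) (auto simp: slocal_step_def)
  then show ?thesis by (simp add: slocal_run_def)
qed

text \<open>Results are never overwritten, so the memory that \<open>v\<close> finds is the final
  run restricted to the nodes before it. This turns the fold into a recursive equation for the final
  run, on which locality can be proved by induction.\<close>

lemma slocal_run_unfold:
  assumes "distinct vs" and vs: "vs = as @ v # bs"
  shows "slocal_run A G x vs v = Some (process A (num_nodes G)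
    (view_at G x (map_option fst \<circ> (slocal_run A G x vs |` set as)) (locality A (num_nodes G)) v))"
proof -
  let ?t = "slocal_run A G x as"
  have run: "slocal_run A G x vs = fold (slocal_step A G x) bs (slocal_step A G x v ?t)"
    by (simp add: slocal_run_def vs)
  have "slocal_run A G x vs u = ?t u" if "u \<in> set as" for u
    unfolding run using that assms(1)
    by (subst fold_slocal_step_other) (auto simp: vs slocal_step_def)
  moreover have "?t u = None" if "u \<notin> set as" for u
    using that dom_slocal_run[of A G x as] by blast
  ultimately have "slocal_run A G x vs |` set as = ?t"
    by (auto simp: restrict_map_def fun_eq_iff)
  moreover have "slocal_run A G x vs v = slocal_step A G x v ?t v"
    unfolding run by (rule fold_slocal_step_other) (use assms(1) vs in simp)
  ultimately show ?thesis by (simp add: slocal_step_def)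
qed

lemma view_at_cong:
  assumes ag: "agree r G G' v"
    and eq: "\<And>u. u \<in> hop_ball G r v \<Longrightarrow> x u = x' u \<and> m u = m' u"
  shows "view_at G x m r v = view_at G' x' m' r v"
proof -
  let ?B = "hop_ball G r v"
  have B: "hop_ball G' r v = ?B" using hop_ball_cong[OF ag] by simp
  have "parcs G \<inter> ?B \<times> ?B = parcs G' \<inter> ?B \<times> ?B"
    using ag by (auto simp: agree_def neighbours_def)
  moreover have "x |` ?B = x' |` ?B" "m |` ?B = m' |` ?B"
    using eq by (auto simp: restrict_map_def fun_eq_iff)
  ultimately show ?thesis by (simp add: view_at_def B)
qed

text \<open>With the identifier as second component the keys are distinct. So whether one node
  precedes another is decided by their own colours and identifiers, whatever the rest of the network
  looks like.\<close>

definition coloured_order :: "(nat \<Rightarrow> nat) \<Rightarrow> nat set \<Rightarrow> nat list" where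
  "coloured_order col V = sort_key (\<lambda>v. (col v, v)) (sorted_list_of_set V)"

lemma set_coloured_order: "finite V \<Longrightarrow> set (coloured_order col V) = V"
  and distinct_coloured_order: "distinct (coloured_order col V)"
  by (simp_all add: coloured_order_def)

lemma coloured_order_prefix:
  assumes "finite V" and vs: "coloured_order col V = as @ v # bs"
  shows "set as = {u \<in> V. (col u, u) < (col v, v)}"
proof -
  let ?key = "\<lambda>v. (col v, v)"
  have "distinct (map ?key (coloured_order col V))"
    by (simp add: distinct_map distinct_coloured_order inj_on_def)
  moreover have "sorted (map ?key (coloured_order col V))"
    by (simp add: coloured_order_def)
  ultimately have "sorted_wrt (<) (map ?key (coloured_order col V))"
    by (simp add: strict_sorted_iff)
  then have less: "\<And>u. u \<in> set as \<Longrightarrow> ?key u < ?key v" "\<And>u. u \<in> set bs \<Longrightarrow> ?key v < ?key u"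
    by (auto simp: vs sorted_wrt_append)
  have V: "V = set as \<union> {v} \<union> set bs"
    using set_coloured_order[OF assms(1), of col] vs by auto
  show ?thesis
  proof (intro set_eqI iffI)
    fix u assume "u \<in> {u \<in> V. ?key u < ?key v}"
    then have "u \<in> V" "?key u < ?key v" by auto
    then show "u \<in> set as" using V less(2)[of u] by fastforce
  qed (use V less(1) in auto)
qed

text \<open>
  A node depends on earlier nodes of its own cluster and on nodes of smaller colour only, since
  clusters of the same colour do not see each other. So every dependency chain crosses at most one
  cluster per colour. The ball is taken around the name of the cluster, because its radius must not
  grow with the number of dependencies inside the cluster.
\<close>

lemma slocal_run_local:
  fixes A :: "('i, 'o) slocal_alg" and n :: nat
  defines "r \<equiv> locality A n"
  defines "run \<equiv> \<lambda>dec G x. slocal_run A G x (coloured_order (fst \<circ> the \<circ> dec G) (pverts G))"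
  assumes loc: "local_fun c n s dec"
    and cen: "centred c n D (\<lambda>G. map_option snd \<circ> dec G)"
    and total: "\<And>G. network c G \<Longrightarrow> num_nodes G = n \<Longrightarrow> pverts G \<subseteq> dom (dec G)"
    and sep: "\<And>G u v k a a'. network c G \<Longrightarrow> num_nodes G = n \<Longrightarrow> v \<in> hop_ball G r u \<Longrightarrow>
        dec G u = Some (k, a) \<Longrightarrow> dec G v = Some (k, a') \<Longrightarrow> a = a'"
    and nw: "network c G" "network c G'" and n: "num_nodes G = n" "num_nodes G' = n"
  shows "dec G v = Some (k, a) \<Longrightarrow> a \<in> pverts G' \<Longrightarrow> agree (s + Suc k * (2 * D + r)) G G' a \<Longrightarrow>
    (\<And>u. u \<in> hop_ball G (s + Suc k * (2 * D + r)) a \<Longrightarrow> x u = x' u) \<Longrightarrow>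
    run dec G x v = run dec G' x' v"
proof (induction k arbitrary: a v rule: less_induct)
  case (less k)
  let ?\<rho> = "\<lambda>k. s + Suc k * (2 * D + r)"
  have centre: "v \<in> pverts G \<and> a \<in> hop_ball G D v \<and> v \<in> hop_ball G D a"
    if "dec G v = Some (k, a)" for k a v
    using that cen nw(1) n(1) hop_ball_sym[OF nw(1)] by (fastforce simp: centred_def)
  have a: "a \<in> pverts G" "a \<in> pverts G'"
    using centre[OF less.prems(1)] hop_ball_verts[OF nw(1)] less.prems(2) by blast+
  show ?case
    using less.prems(1)
  \<comment> \<open>Inside a cluster the order is that of identifiers. This inner induction keeps
    \<open>a\<close> and thus the ball.\<close>
  proof (induction v rule: less_induct)
    case inner: (less v)
    note ag = less.prems(3)
    have in_ball: "u \<in> hop_ball G (D + r) a" if "u \<in> hop_ball G r v" for u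
      using centre[OF inner.prems] that hop_ball_trans by blast
    have verts: "u \<in> pverts G \<and> u \<in> pverts G'" if u: "u \<in> hop_ball G (D + r) a" for u
    proof -
      have "hop_ball G (D + r) a = hop_ball G' (D + r) a"
        by (rule hop_ball_cong_le[OF ag]) simp
      then show ?thesis using u hop_ball_verts nw a by metis
    qed
    have dec: "dec G u = dec G' u" if u: "u \<in> hop_ball G (D + r) a" for u
    proof -
      have "agree s G G' u" by (rule agree_subball[OF ag u]) simp
      then show ?thesis using loc verts[OF u] nw n by (auto simp: local_fun_def)
    qed
    have v: "v \<in> hop_ball G r v" by simp
    define key where "key G v = ((fst \<circ> the \<circ> dec G) v, v)" for G v
    have key: "key G u = key G' u" if "u \<in> hop_ball G r v" for u
      using dec[OF in_ball[OF that]] by (simp add: key_def)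
    have unfold: "run dec G x v = Some (process A n
        (view_at G x (map_option fst \<circ> (run dec G x |` {u \<in> pverts G. key G u < key G v})) r v))"
      if "network c G" "num_nodes G = n" "v \<in> pverts G" for G x
    proof -
      let ?vs = "coloured_order (fst \<circ> the \<circ> dec G) (pverts G)"
      have fin: "finite (pverts G)" using networkD(1)[OF that(1)] .
      have "v \<in> set ?vs" using fin that(3) by (simp add: set_coloured_order)
      then obtain as bs where vs: "?vs = as @ v # bs" by (meson split_list)
      have "set as = {u \<in> pverts G. key G u < key G v}"
        using coloured_order_prefix[OF fin vs] by (simp add: key_def)
      then show ?thesis
        using slocal_run_unfold[OF distinct_coloured_order vs, of A G x] that(2)
        by (simp add: run_def r_def)
    qed
    have mem: "run dec G x u = run dec G' x' u"
      if u: "u \<in> hop_ball G r v" and less_key: "key G u < key G v" for u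
    proof -
      from verts[OF in_ball[OF u]] total[OF nw(1) n(1)] obtain k' a' where u': "dec G u = Some (k', a')"
        by fastforce
      show ?thesis
      proof (cases "k' = k")
        case True
        then have "a = a'" using sep[OF nw(1) n(1) u] inner.prems u' by blast
        moreover have "u < v" using less_key u' inner.prems True by (simp add: key_def)
        ultimately show ?thesis using inner.IH u' True by blast
      next
        case False
        then have k': "k' < k" using less_key u' inner.prems by (auto simp: key_def)
        \<comment> \<open>The origin of \<open>2 * D + r\<close> per colour: from the name
          \<open>a\<close> to \<open>v\<close>, from \<open>v\<close> to \<open>u\<close> in its
          view, and on to the name \<open>a'\<close> of the cluster of \<open>u\<close>.\<close>
        have a': "a' \<in> hop_ball G (D + r + D) a"
          using centre[OF u'] in_ball[OF u] hop_ball_trans by blast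
        have "Suc (Suc k') * (2 * D + r) \<le> Suc k * (2 * D + r)"
          using k' by (intro mult_le_mono1) simp
        then have \<rho>: "D + r + D + ?\<rho> k' \<le> ?\<rho> k" by simp
        have "hop_ball G (D + r + D) a = hop_ball G' (D + r + D) a"
          by (rule hop_ball_cong_le[OF ag]) (use \<rho> in simp)
        then have "a' \<in> pverts G'" using a' a(2) hop_ball_verts[OF nw(2)] by blast
        moreover have "agree (?\<rho> k') G G' a'"
          by (rule agree_subball[OF ag a' \<rho>])
        moreover have "x w = x' w" if "w \<in> hop_ball G (?\<rho> k') a'" for w
          using less.prems(4) hop_ball_mono[OF \<rho>] hop_ball_trans[OF a' that] by blast
        ultimately show ?thesis using less.IH[OF k' u'] by blast
      qed
    qed
    have "view_at G x (map_option fst \<circ> (run dec G x |` {u \<in> pverts G. key G u < key G v})) r v =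
      view_at G' x' (map_option fst \<circ> (run dec G' x' |` {u \<in> pverts G'. key G' u < key G' v})) r v"
    proof (rule view_at_cong)
      have "v \<in> hop_ball G D a" using centre[OF inner.prems] by blast
      then show "agree r G G' v" by (rule agree_subball[OF ag]) simp
      fix u assume u: "u \<in> hop_ball G r v"
      have "u \<in> hop_ball G (?\<rho> k) a"
        by (rule hop_ball_mono[OF _ in_ball[OF u]]) simp
      then show "x u = x' u \<and>
        (map_option fst \<circ> (run dec G x |` {u \<in> pverts G. key G u < key G v})) u =
        (map_option fst \<circ> (run dec G' x' |` {u \<in> pverts G'. key G' u < key G' v})) u"
        using less.prems(4) verts[OF in_ball[OF u]] mem[OF u] key[OF u] key[OF v]
        by (auto simp: restrict_map_def)
    qed
    then show ?case
      using unfold[OF nw(1) n(1)] unfold[OF nw(2) n(2)] verts[OF in_ball[OF v]] by simp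
  qed
qed


section \<open>Polylogarithmic bounds\<close>

lemma eventually_one_le_ln: "eventually (\<lambda>n. 1 \<le> ln (real n)) sequentially"
proof (rule eventually_sequentiallyI)
  fix n :: nat assume "3 \<le> n"
  then have "exp 1 \<le> real n" using exp_le by linarith
  then show "1 \<le> ln (real n)" using \<open>3 \<le> n\<close> by (subst ln_ge_iff) auto
qed

lemma polylog_const: "polylog (\<lambda>n. a)"
  unfolding polylog_def by (rule exI[of _ 0]) simp

lemma polylog_mult:
  assumes "polylog f" and "polylog g"
  shows "polylog (\<lambda>n. f n * g n)"
proof -
  from assms obtain k l where "f \<in> O(\<lambda>n. ln (real n) ^ k)" "g \<in> O(\<lambda>n. ln (real n) ^ l)"
    by (auto simp: polylog_def)
  then have "(\<lambda>n. f n * g n) \<in> O(\<lambda>n. ln (real n) ^ (k + l))"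
    unfolding power_add by (rule landau_o.big.mult)
  then show ?thesis by (auto simp: polylog_def)
qed

lemma polylog_add:
  assumes "polylog f" and "polylog g"
  shows "polylog (\<lambda>n. f n + g n)"
proof -
  have mono: "(\<lambda>n. ln (real n) ^ k) \<in> O(\<lambda>n. ln (real n) ^ m)" if "k \<le> m" for k m
  proof (rule bigoI[of _ 1])
    show "eventually (\<lambda>n. norm (ln (real n) ^ k) \<le> 1 * norm (ln (real n) ^ m)) sequentially"
      using eventually_one_le_ln by eventually_elim (use that in \<open>simp add: power_increasing\<close>)
  qed
  from assms obtain k l where "f \<in> O(\<lambda>n. ln (real n) ^ k)" "g \<in> O(\<lambda>n. ln (real n) ^ l)"
    by (auto simp: polylog_def)
  then have "f \<in> O(\<lambda>n. ln (real n) ^ max k l)" "g \<in> O(\<lambda>n. ln (real n) ^ max k l)"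
    using mono[of k "max k l"] mono[of l "max k l"] landau_o.big_trans by force+
  then have "(\<lambda>n. f n + g n) \<in> O(\<lambda>n. ln (real n) ^ max k l)" by (rule sum_in_bigo)
  then show ?thesis by (auto simp: polylog_def)
qed

section \<open>Logarithm of the network size and number of carving steps\<close>

definition bit_length :: "nat \<Rightarrow> nat" where
  "bit_length n = Suc (nat \<lfloor>log 2 (real n)\<rfloor>)"

lemma less_power_bit_length:
  assumes "n > 0"
  shows "n < 2 ^ bit_length n"
proof -
  have "log 2 (real n) < real (bit_length n)"
    using assms by (simp add: bit_length_def) linarith
  then have "real n < 2 powr real (bit_length n)"
    using assms by (simp add: log_less_iff)
  then have "real n < real (2 ^ bit_length n)" by (simp add: powr_realpow)
  then show ?thesis by (simp only: of_nat_less_iff)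
qed

lemma polylog_bit_length: "polylog (\<lambda>n. real (bit_length n))"
  unfolding polylog_def
proof (rule exI[of _ 1], rule bigoI[of _ "1 / ln 2 + 1"])
  show "eventually (\<lambda>n. norm (real (bit_length n)) \<le> (1 / ln 2 + 1) * norm (ln (real n) ^ 1)) sequentially"
    using eventually_one_le_ln
  proof eventually_elim
    fix n :: nat assume ln: "1 \<le> ln (real n)"
    then have "0 \<le> log 2 (real n)" by (simp add: log_def)
    then have "real (bit_length n) \<le> log 2 (real n) + 1" by (simp add: bit_length_def)
    also have "\<dots> \<le> (1 / ln 2 + 1) * ln (real n)"
      using ln by (simp add: log_def algebra_simps)
    finally show "norm (real (bit_length n)) \<le> (1 / ln 2 + 1) * norm (ln (real n) ^ 1)"
      using ln by simp
  qed
qed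

text \<open>Bernoulli's inequality \<open>1 + j / K \<le> (1 + 1 / K) ^ j\<close>, multiplied by
  \<open>K ^ (j + 1)\<close>.\<close>

lemma Suc_power_ge: "(K + j) * K ^ j \<le> K * Suc K ^ j"
proof (induction j)
  case (Suc j)
  have "(K + Suc j) * K ^ Suc j \<le> Suc K * ((K + j) * K ^ j)"
    by (simp add: algebra_simps)
  also have "\<dots> \<le> Suc K * (K * Suc K ^ j)"
    by (rule mult_le_mono2[OF Suc])
  finally show ?case by (simp add: algebra_simps)
qed simp

text \<open>By Bernoulli's inequality, \<open>K\<close> steps of growth by \<open>1 + 1 / K\<close>
  at least double a cluster, so \<open>K * l\<close> steps exceed every \<open>n\<close> below
  \<open>2 ^ l\<close>. This dictates the number of steps per phase.\<close>

lemma power_growth: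
  fixes K l n :: nat
  assumes "K > 0" and "n < 2 ^ l"
  shows "n * K ^ (K * l) < Suc K ^ (K * l)"
proof -
  have "K * (2 * K ^ K) \<le> K * Suc K ^ K" using Suc_power_ge[of K K]
    by (simp only: mult_2 add_mult_distrib add_mult_distrib2)
  then have "2 * K ^ K \<le> Suc K ^ K" using assms(1) by (metis mult_le_cancel1)
  then have "(2 * K ^ K) ^ l \<le> (Suc K ^ K) ^ l" by (rule power_mono) simp
  then have "2 ^ l * K ^ (K * l) \<le> Suc K ^ (K * l)"
    by (simp only: power_mult_distrib power_mult)
  moreover have "n * K ^ (K * l) < 2 ^ l * K ^ (K * l)" using assms by simp
  ultimately show ?thesis by (rule less_le_trans[rotated])
qed

section \<open>Inclusion of P-SLOCAL in P-LOCAL\<close>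

theorem P_SLOCAL_subset_P_LOCAL:
  fixes Q :: "(nat, 'o) problem"
  assumes "Q \<in> P_SLOCAL"
  shows "Q \<in> P_LOCAL"
  unfolding P_LOCAL_def
proof (intro CollectI allI)
  fix c
  from assms obtain A where A: "polylog (\<lambda>n. real (locality A n))" "slocal_solves c A Q"
    by (auto simp: P_SLOCAL_def)
  define r where "r = locality A"
  \<comment> \<open>Identifiers are below \<open>n ^ c\<close> and so fit into
    \<open>c * bit_length n\<close> bits; \<open>Suc\<close> makes \<open>b n\<close> positive, as
    halving requires. \<open>T\<close> comes from \<open>power_growth\<close> with
    \<open>K = 2 * b n\<close>, and \<open>D\<close> counts \<open>r\<close> for each carving
    step.\<close>
  define b where "b n = Suc (c * bit_length n)" for n
  define T where "T n = 2 * b n * bit_length n" for n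
  define D where "D n = b n * T n * r n" for n
  define s where "s n = bit_length n * (b n * T n * (3 * r n + 2 * D n))" for n
  \<comment> \<open>The locality of the decomposition, then \<open>2 * D n + r n\<close> per colour,
    and a last \<open>D n\<close> from a node to the name of its cluster, around which
    \<open>slocal_run_local\<close> takes its ball.\<close>
  define \<rho> where "\<rho> n = s n + Suc (bit_length n) * (2 * D n + r n) + D n" for n
  define dec where "dec G = (let n = num_nodes G in
    colouring (hop_ball G (r n)) (T n) (b n) (pverts G) (bit_length n))" for G
  define run where
    "run G x = slocal_run A G x (coloured_order (fst \<circ> the \<circ> dec G) (pverts G))" for G x
  define f where "f G x v = snd (the (run G x v))" for G x v

  have local: "local_fun c n (s n) dec" and cen: "centred c n (D n) (\<lambda>G. map_option snd \<circ> dec G)" for n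
  proof -
    let ?col = "\<lambda>G. colouring (hop_ball G (r n)) (T n) (b n) (pverts G) (bit_length n)"
    have dec: "dec G = ?col G" if "num_nodes G = n" for G
      using that by (simp add: dec_def)
    have "local_fun c n (s n) ?col" and "centred c n (D n) (\<lambda>G. map_option snd \<circ> ?col G)"
      using colouring_local_centred[of c n "bit_length n" "b n" "T n" "r n"]
      unfolding s_def D_def by blast+
    then show "local_fun c n (s n) dec" "centred c n (D n) (\<lambda>G. map_option snd \<circ> dec G)"
      by (auto intro: local_fun_cong centred_cong simp: dec)
  qed
  have total: "pverts G \<subseteq> dom (dec G)" if nw: "network c G" for G
  proof -
    have "finite (pverts G)" using networkD(1)[OF nw] .
    moreover have "card (pverts G) < 2 ^ bit_length (num_nodes G)"
      using less_power_bit_length[of "num_nodes G"] nw networkD(1)[OF nw]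
      by (auto simp: num_nodes_def network_def card_gt_0_iff)
    ultimately show ?thesis
      unfolding dec_def Let_def
      by (intro colouring_total[where N = "hop_ball G (r (num_nodes G))"])
        (use hop_ball_sym[OF nw] in \<open>auto simp: b_def\<close>)
  qed
  have sep: "a = a'" if nw: "network c G" and v: "v \<in> hop_ball G (r (num_nodes G)) u"
    and col: "dec G u = Some (k, a)" "dec G v = Some (k, a')" for G u v k a a'
  proof -
    let ?n = "num_nodes G"
    have n: "?n < 2 ^ bit_length ?n"
      using less_power_bit_length[of ?n] nw networkD(1)[OF nw]
      by (auto simp: num_nodes_def network_def card_gt_0_iff)
    \<comment> \<open>Separation compares only the low \<open>b\<close> bits of the names. Names are
      identifiers of nodes, hence below \<open>2 ^ b\<close>, so these bits determine them.\<close>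
    have "a \<in> pverts G" "a' \<in> pverts G"
      using cen[of ?n] nw col hop_ball_verts[OF nw] by (fastforce simp: centred_def)+
    then have "a < ?n ^ c" "a' < ?n ^ c" using networkD(4)[OF nw] by auto
    moreover have "?n ^ c \<le> 2 ^ b ?n"
    proof -
      have "?n ^ c \<le> (2 ^ bit_length ?n) ^ c" using n by (intro power_mono) auto
      also have "\<dots> = 2 ^ (c * bit_length ?n)" by (simp add: power_mult[symmetric] mult.commute)
      also have "\<dots> \<le> 2 ^ b ?n" by (intro power_increasing) (auto simp: b_def)
      finally show ?thesis .
    qed
    moreover have "take_bit (b ?n) a = take_bit (b ?n) a'"
    proof (rule colouring_separated[where N = "hop_ball G (r ?n)"])
      show "card (pverts G) * (2 * b ?n) ^ T ?n < Suc (2 * b ?n) ^ T ?n"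
        using power_growth[OF _ n, of "2 * b ?n"] by (simp add: T_def num_nodes_def b_def)
    qed (use v col hop_ball_sym[OF nw] networkD(1)[OF nw] in \<open>auto simp: dec_def Let_def\<close>)
    ultimately show ?thesis by (simp add: take_bit_nat_eq_self)
  qed

  have "\<exists>A'. rounds A' = (\<lambda>n. Suc (\<rho> n)) \<and> local_solves c A' Q"
  proof (rule local_alg_of_local_function)
    fix G x assume vi: "valid_input Q c G x"
    then have fin: "finite (pverts G)" using networkD(1) by (auto simp: valid_input_def)
    let ?vs = "coloured_order (fst \<circ> the \<circ> dec G) (pverts G)"
    have "slocal_output A G x ?vs v = (if v \<in> pverts G then Some (f G x v) else None)" for v
    proof -
      have "slocal_output A G x ?vs = map_option snd \<circ> run G x"
        by (simp add: slocal_output_def run_def slocal_run_def)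
      moreover have "dom (run G x) = pverts G"
        by (simp add: run_def dom_slocal_run set_coloured_order[OF fin])
      ultimately show ?thesis by (cases "run G x v") (auto simp: f_def)
    qed
    then have "slocal_output A G x ?vs = (\<lambda>v. if v \<in> pverts G then Some (f G x v) else None)" by auto
    then show "is_solution Q G x (\<lambda>v. if v \<in> pverts G then Some (f G x v) else None)"
      using A(2) vi set_coloured_order[OF fin] distinct_coloured_order
      by (metis slocal_solves_def)
  next
    fix G x G' x' v
    assume vi: "valid_input Q c G x" "valid_input Q c G' x'" and n: "num_nodes G' = num_nodes G"
      and v: "v \<in> pverts G" "v \<in> pverts G'" and ag: "agree (\<rho> (num_nodes G)) G G' v"
      and x: "\<And>u. u \<in> hop_ball G (\<rho> (num_nodes G)) v \<Longrightarrow> x u = x' u"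
    let ?n = "num_nodes G"
    have nw: "network c G" "network c G'" using vi by (auto simp: valid_input_def)
    from total[OF nw(1)] v(1) obtain k a where dec: "dec G v = Some (k, a)" by fastforce
    have k: "k < bit_length ?n" using dec colouring_less by (auto simp: dec_def Let_def)
    have a: "a \<in> hop_ball G (D ?n) v"
      using cen[of ?n] nw(1) dec by (auto simp: centred_def)
    have "Suc k * (2 * D ?n + r ?n) \<le> Suc (bit_length ?n) * (2 * D ?n + r ?n)"
      using k by (intro mult_le_mono1) simp
    then have \<rho>: "D ?n + (s ?n + Suc k * (2 * D ?n + r ?n)) \<le> \<rho> ?n" by (simp add: \<rho>_def)
    have a': "a \<in> pverts G'"
    proof -
      have "hop_ball G (D ?n) v = hop_ball G' (D ?n) v"
        by (rule hop_ball_cong_le[OF ag]) (simp add: \<rho>_def)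
      then show ?thesis using a v(2) hop_ball_verts[OF nw(2)] by blast
    qed
    have "run G x v = run G' x' v"
      unfolding run_def
    proof (rule slocal_run_local[where n = ?n and c = c and dec = dec and D = "D ?n" and s = "s ?n"
          and G = G and G' = G' and k = k and a = a])
      show "agree (s ?n + Suc k * (2 * D ?n + locality A ?n)) G G' a"
        using agree_subball[OF ag a] \<rho> by (simp add: r_def)
      show "x u = x' u" if "u \<in> hop_ball G (s ?n + Suc k * (2 * D ?n + locality A ?n)) a" for u
        using x hop_ball_mono[OF \<rho>] hop_ball_trans[OF a] that by (metis r_def)
      show "pverts H \<subseteq> dom (dec H)" if "network c H" for H
        by (rule total[OF that])
      show "i = j" if "network c H" "num_nodes H = ?n" "w \<in> hop_ball H (locality A ?n) u"
        "dec H u = Some (l, i)" "dec H w = Some (l, j)" for H u w l i j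
        using sep[OF that(1) _ that(4,5)] that(2,3) by (simp add: r_def)
    qed (rule local cen nw n dec a' refl)+
    then show "f G x v = f G' x' v" by (simp add: f_def)
  qed
  then obtain A' where A': "rounds A' = (\<lambda>n. Suc (\<rho> n))" "local_solves c A' Q" by blast
  have r: "polylog (\<lambda>n. real (r n))" using A(1) by (simp add: r_def)
  have "polylog (\<lambda>n. real (rounds A' n))"
    unfolding A'(1) \<rho>_def s_def D_def T_def b_def Suc_eq_plus1 of_nat_add of_nat_mult
    by (intro polylog_add polylog_mult polylog_const polylog_bit_length r)
  with A'(2) show "\<exists>A. polylog (\<lambda>n. real (rounds A n)) \<and> local_solves c A Q" by blast
qed


section \<open>The greedy algorithm for star sets\<close>

text \<open>Centres of stars with a common leaf are at distance at most 2, hence the locality of the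
  algorithm: the numbers stored in the view decode to all leaves already taken by such
  centres.\<close>

definition free_leaves :: "(side \<times> nat) view \<Rightarrow> nat set" where
  "free_leaves w = neighbours (view_graph w) (centre w) - \<Union> (set_decode ` ran (view_memory w))"

definition greedy_star :: "nat \<Rightarrow> (side \<times> nat) view \<Rightarrow> nat set option" where
  "greedy_star k w =
     (if fst (the (view_input w (centre w))) = LSide \<and> (\<exists>S\<subseteq>free_leaves w. finite S \<and> card S = k)
      then Some (SOME S. S \<subseteq> free_leaves w \<and> finite S \<and> card S = k) else None)"

text \<open>A node stores the code of its set of leaves, which is the code of \<open>{}\<close> if it has no star.\<close>

definition greedy_alg :: "(nat \<Rightarrow> real) \<Rightarrow> (side \<times> nat, nat set option) slocal_alg" where
  "greedy_alg lam =
     \<lparr> locality = (\<lambda>n. 2),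
       process = (\<lambda>n w.
         let S = greedy_star (nat \<lceil>lam n * real (snd (the (view_input w (centre w))))\<rceil>) w
         in (set_encode (case S of None \<Rightarrow> {} | Some S \<Rightarrow> S), S)) \<rparr>"

section \<open>Correctness of the greedy algorithm\<close>

lemma greedy_alg_sel:
  "locality (greedy_alg lam) n = 2"
  "process (greedy_alg lam) n w =
     (let S = greedy_star (nat \<lceil>lam n * real (snd (the (view_input w (centre w))))\<rceil>) w
      in (set_encode (case S of None \<Rightarrow> {} | Some S \<Rightarrow> S), S))"
  by (simp_all add: greedy_alg_def)

lemma view_at_sel:
  "centre (view_at G x m r v) = v"
  "view_graph (view_at G x m r v) =
     \<lparr>pverts = hop_ball G r v, parcs = parcs G \<inter> hop_ball G r v \<times> hop_ball G r v\<rparr>"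
  "view_input (view_at G x m r v) = x |` hop_ball G r v"
  "view_memory (view_at G x m r v) = m |` hop_ball G r v"
  by (simp_all add: view_at_def Let_def)

lemma greedy_star_SomeD:
  assumes "greedy_star k w = Some S"
  shows "fst (the (view_input w (centre w))) = LSide" and "S \<subseteq> free_leaves w"
    and "finite S" and "card S = k"
proof -
  from assms have *: "\<exists>S. S \<subseteq> free_leaves w \<and> finite S \<and> card S = k"
    and "fst (the (view_input w (centre w))) = LSide"
    and S: "S = (SOME S. S \<subseteq> free_leaves w \<and> finite S \<and> card S = k)"
    by (auto simp: greedy_star_def split: if_splits)
  then show "fst (the (view_input w (centre w))) = LSide" by simp
  from someI_ex[OF *] show "S \<subseteq> free_leaves w" "finite S" "card S = k"
    unfolding S by auto
qed

lemma greedy_star_NoneD: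
  "greedy_star k w = None \<Longrightarrow> fst (the (view_input w (centre w))) = LSide \<Longrightarrow>
     S \<subseteq> free_leaves w \<Longrightarrow> finite S \<Longrightarrow> card S \<noteq> k"
  by (auto simp: greedy_star_def split: if_splits)

lemma split_list_two:
  assumes "u \<in> set vs" and "v \<in> set vs" and "u \<noteq> v"
  obtains as bs where "vs = as @ v # bs" "u \<in> set as" | as bs where "vs = as @ u # bs" "v \<in> set as"
proof -
  obtain as bs where vs: "vs = as @ v # bs" using split_list[OF assms(2)] by blast
  show ?thesis
  proof (cases "u \<in> set as")
    case True
    then show ?thesis using that(1) vs by blast
  next
    case False
    then obtain cs ds where "bs = cs @ u # ds" using assms(1,3) vs split_list by fastforce
    then show ?thesis using that(2)[of "as @ v # cs" ds] vs by simp
  qed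
qed

text \<open>Independence: of two centres sharing a leaf, the later one would have seen it taken by
  the earlier one; and a centre is never a leaf, as they lie on different sides. Maximality: the
  leaves of a star that could be added were free when its centre was processed, so the centre would
  have taken some star itself.\<close>

lemma greedy_alg_maximal:
  assumes nw: "network c G" and bi: "bipartite_input G L R d x"
    and vs: "distinct vs" "set vs = pverts G"
  shows "maximal_independent_star_set G L (nat \<lceil>lam (num_nodes G) * real d\<rceil>)
    {(u, S). slocal_output (greedy_alg lam) G x vs u = Some (Some S)}"
proof -
  let ?k = "nat \<lceil>lam (num_nodes G) * real d\<rceil>"
  define run where "run = slocal_run (greedy_alg lam) G x vs"
  define y where "y = slocal_output (greedy_alg lam) G x vs"
  define M where "M = {(u, S). y u = Some (Some S)}"
  define view where
    "view as v = view_at G x (map_option fst \<circ> (run |` set as)) 2 v" for as v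
  have y: "y = map_option snd \<circ> run"
    by (simp add: y_def run_def slocal_output_def slocal_run_def)
  have verts: "pverts G = L \<union> R" "L \<inter> R = {}" and arcs: "parcs G \<subseteq> L \<times> R \<union> R \<times> L"
    and x: "x = (\<lambda>v. if v \<in> L then Some (LSide, d) else if v \<in> R then Some (RSide, d) else None)"
    using bi by (auto simp: bipartite_input_def)
  have run_at: "run v = Some (set_encode (case greedy_star ?k (view as v) of None \<Rightarrow> {} | Some S \<Rightarrow> S),
      greedy_star ?k (view as v))" if split: "vs = as @ v # bs" for as v bs
  proof -
    have "v \<in> pverts G" using vs(2) split by auto
    then have "snd (the (x v)) = d" using verts by (auto simp: x)
    then show ?thesis
      using slocal_run_unfold[OF vs(1) split, of "greedy_alg lam" G x]
      by (simp add: run_def[symmetric] view_def greedy_alg_sel Let_def view_at_sel)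
  qed
  have left: "fst (the (view_input (view as v) (centre (view as v)))) = LSide \<longleftrightarrow> v \<in> L"
    if "v \<in> pverts G" for as v
    using that verts by (auto simp: view_def view_at_sel x)
  have y_at: "y v = Some (greedy_star ?k (view as v))" if "vs = as @ v # bs" for as v bs
    using run_at[OF that] by (simp add: y)
  have mem: "run v = Some (set_encode S, Some S) \<and> finite S" if "y v = Some (Some S)" for v S
  proof -
    have "v \<in> set vs"
      using that dom_slocal_run[of "greedy_alg lam" G x vs] by (auto simp: y run_def)
    then obtain as bs where "vs = as @ v # bs" by (meson split_list)
    then show ?thesis using that run_at y_at greedy_star_SomeD(3) by fastforce
  qed
  have free: "free_leaves (view as v) =
      neighbours G v - \<Union> {S. \<exists>u\<in>set as. u \<in> hop_ball G 2 v \<and> y u = Some (Some S)}" for as v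
  proof -
    have nb: "u \<in> hop_ball G 2 v" if "u \<in> neighbours G v" for u
      using that by (auto simp: numeral_2_eq_2 hop_ball_Suc)
    have "neighbours (view_graph (view as v)) (centre (view as v)) = neighbours G v"
      using nb by (auto simp: view_def view_at_sel neighbours_def)
    moreover have "\<Union> (set_decode ` ran (view_memory (view as v))) =
      \<Union> {S. \<exists>u\<in>set as. u \<in> hop_ball G 2 v \<and> y u = Some (Some S)}" (is "?U = ?V")
    proof
      show "?U \<subseteq> ?V"
      proof
        fix w assume "w \<in> ?U"
        then obtain u m o' where u: "u \<in> hop_ball G 2 v" "u \<in> set as" "run u = Some (m, o')" "w \<in> set_decode m"
          by (auto simp: view_def view_at_sel ran_def restrict_map_def split: if_splits)
        have "u \<in> set vs" using u(3) dom_slocal_run[of "greedy_alg lam" G x vs] by (auto simp: run_def)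
        then obtain as' bs' where split: "vs = as' @ u # bs'" by (meson split_list)
        \<comment> \<open>A node without a star stores the code of the empty set, which does not
          contain \<open>w\<close>.\<close>
        from run_at[OF split] u(3,4) obtain S where "o' = Some S"
          by (cases o') auto
        then have "y u = Some (Some S)" using u(3) by (simp add: y)
        moreover from mem[OF this] u(3,4) have "w \<in> S" by auto
        ultimately show "w \<in> ?V" using u(1,2) by blast
      qed
      show "?V \<subseteq> ?U"
      proof
        fix w assume "w \<in> ?V"
        then obtain u S where u: "u \<in> set as" "u \<in> hop_ball G 2 v" "y u = Some (Some S)" "w \<in> S" by blast
        have "view_memory (view as v) u = Some (set_encode S)"
          using u mem[OF u(3)] by (simp add: view_def view_at_sel)
        then have "set_encode S \<in> ran (view_memory (view as v))" by (rule ranI)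
        moreover have "w \<in> set_decode (set_encode S)" using u(4) mem[OF u(3)] by simp
        ultimately show "w \<in> ?U" by blast
      qed
    qed
    ultimately show ?thesis by (simp add: free_leaves_def)
  qed
  have star: "u \<in> L \<and> S \<subseteq> neighbours G u \<and> finite S \<and> card S = ?k"
    if "y u = Some (Some S)" for u S
  proof -
    have "u \<in> set vs"
      using that dom_slocal_run[of "greedy_alg lam" G x vs] by (auto simp: y run_def)
    then obtain as bs where split: "vs = as @ u # bs" by (meson split_list)
    have "greedy_star ?k (view as u) = Some S" using y_at[OF split] that by simp
    from greedy_star_SomeD[OF this] show ?thesis
      using left[of u as] \<open>u \<in> set vs\<close> vs(2) free by auto
  qed
  have nb_R: "w \<in> R" if "u \<in> L" "w \<in> neighbours G u" for u w
    using that arcs verts(2) by (auto simp: neighbours_def)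
  have disj: "S \<inter> S' = {}"
    if u: "y u = Some (Some S)" and v: "y v = Some (Some S')"
      and split: "vs = as @ v # bs" and before: "u \<in> set as" for u v S S' as bs
  proof -
    have "greedy_star ?k (view as v) = Some S'" using y_at[OF split] v by simp
    then have S': "S' \<subseteq> free_leaves (view as v)" by (rule greedy_star_SomeD)
    have False if w: "w \<in> S" "w \<in> S'" for w
    proof -
      have "w \<in> neighbours G v" "u \<in> neighbours G w"
        using w star[OF u] star[OF v] networkD(3)[OF nw] by auto
      then have "u \<in> hop_ball G 2 v" by (auto simp: numeral_2_eq_2 hop_ball_Suc)
      then show False using S' w u before unfolding free by blast
    qed
    then show ?thesis by blast
  qed
  have indep: "independent_star_set G L ?k M"
    unfolding independent_star_set_def
  proof (intro conjI ballI pairwiseI)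
    fix s assume "s \<in> M"
    then show "is_star G L ?k s" using star by (auto simp: M_def is_star_def)
  next
    fix s t assume "s \<in> M" "t \<in> M" "s \<noteq> t"
    then obtain u S v S' where st: "s = (u, S)" "t = (v, S')" "y u = Some (Some S)" "y v = Some (Some S')"
      by (auto simp: M_def)
    with \<open>s \<noteq> t\<close> have "u \<noteq> v" by auto
    have "u \<in> set vs" "v \<in> set vs" using star st vs(2) verts(1) by auto
    then have "S \<inter> S' = {}"
      using \<open>u \<noteq> v\<close>
    proof (cases rule: split_list_two)
      case (1 as bs)
      then show ?thesis using disj[OF st(3,4)] by blast
    next
      case (2 as bs)
      then show ?thesis using disj[OF st(4,3)] by blast
    qed
    moreover have "u \<notin> S'" "v \<notin> S"
      using star[OF st(3)] star[OF st(4)] nb_R verts(2) by blast+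
    ultimately show "disjnt (star_nodes s) (star_nodes t)"
      using \<open>u \<noteq> v\<close> by (auto simp: st star_nodes_def disjnt_def)
  qed
  have "M' = M" if M': "independent_star_set G L ?k M'" "M \<subseteq> M'" for M'
  proof
    show "M' \<subseteq> M"
    proof
      fix s assume s: "s \<in> M'"
      obtain u S where us: "s = (u, S)" by (cases s)
      have st: "u \<in> L" "S \<subseteq> neighbours G u" "finite S" "card S = ?k"
        using M'(1) s by (auto simp: independent_star_set_def is_star_def us)
      \<comment> \<open>Both stars lie in \<open>M'\<close>, so they are equal or disjoint; in
        particular a common centre forces equality.\<close>
      have disj': "u = v \<and> S = S' \<or> u \<noteq> v \<and> S \<inter> S' = {}" if "y v = Some (Some S')" for v S'
      proof -
        have "(v, S') \<in> M'" using that M'(2) by (auto simp: M_def)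
        then have "s = (v, S') \<or> disjnt (star_nodes s) (star_nodes (v, S'))"
          using M'(1) s by (auto simp: independent_star_set_def pairwise_def)
        then show ?thesis by (auto simp: us star_nodes_def disjnt_def)
      qed
      have "u \<in> set vs" using st(1) verts(1) vs(2) by auto
      then obtain as bs where split: "vs = as @ u # bs" by (meson split_list)
      show "s \<in> M"
      proof (cases "y u = Some None")
        case True
        then have "greedy_star ?k (view as u) = None" using y_at[OF split] by simp
        moreover have "S \<subseteq> free_leaves (view as u)"
        proof -
          have "u \<notin> set as" using vs(1) split by simp
          then show ?thesis using st(2) disj' unfolding free by fastforce
        qed
        ultimately have False
          using greedy_star_NoneD st(1,3,4) left[of u as] \<open>u \<in> set vs\<close> vs(2) by blast
        then show ?thesis ..
      next
        case False
        then obtain S' where "y u = Some (Some S')" using y_at[OF split] by (metis not_None_eq)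
        then show ?thesis using disj' by (auto simp: M_def us)
      qed
    qed
  qed (rule M'(2))
  with indep show ?thesis
    by (simp add: maximal_independent_star_set_def M_def y_def)
qed

theorem star_set_problem_in_P_SLOCAL: "star_set_problem lam \<in> P_SLOCAL"
  unfolding P_SLOCAL_def
proof (intro CollectI allI exI conjI)
  fix c
  show "polylog (\<lambda>n. real (locality (greedy_alg lam) n))"
    by (simp add: greedy_alg_def polylog_const)
  show "slocal_solves c (greedy_alg lam) (star_set_problem lam)"
    unfolding slocal_solves_def valid_input_def
    by (auto simp: star_set_problem_def intro: greedy_alg_maximal)
qed

theorem theorem7p7:
  fixes lam p :: "nat \<Rightarrow> real"
  assumes "polylog p"
    and "\<And>n. n \<ge> 1 \<Longrightarrow> p n > 0"
    and "\<And>n. n \<ge> 1 \<Longrightarrow> lam n \<ge> 1 / p n"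
  shows "P_SLOCAL_complete (star_set_problem lam)"
  unfolding P_SLOCAL_complete_def
  using star_set_problem_in_P_SLOCAL P_SLOCAL_subset_P_LOCAL by blast

end
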